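(* Let $\mu$ be a bounded, monotone, submodular, strictly positive set function on $\mathcal{B}_{[0,1]}$, which also is continuous by increasing sequences of sets, that is, if $A_n\in\mathcal{B}_{[0,1]}$, $n\in\mathbb{N}$, with $A_n\subset A_{n+1}$ for all $n$ and $A:=\bigcup_{n=1}^{\infty}A_n\in\mathcal{B}_{[0,1]}$, then $\lim_{n\to\infty}\mu(A_n)=\mu(A)$. Also, let $\delta$ be a bounded, strictly positive Borel measure on $\mathcal{B}_{[0,1]}$, such that $\mu(A)\le\delta(A)$ for all $A\in\mathcal{B}_{[0,1]}$. Then, for any $p>1$, $L^{p}_{\delta,+}\subset L^{p}_{\mu,+}$, and for the Bernstein-Durrmeyer-Choquet operators $$\overline{D}_{n,\delta,\mu}(f)(x)=\sum_{k=0}^{n-1}p_{n,k}(x)\cdot\frac{\int_{0}^{1}f(t)p_{n,k}(t)\,d\delta(t)}{\int_{0}^{1}p_{n,k}(t)\,d\delta(t)}+x^{n}\cdot\frac{(C)\int_{0}^{1}f(t)t^{n}\,d\mu(t)}{(C)\int_{0}^{1}t^{n}\,d\mu(t)},$$ for all $f\in L^{p}_{\delta,+}$ and $n\in\mathbb{N}$, with $\varphi_x(t)=|t-x|$, we have $$\|f-\overline{D}_{n,\delta,\mu}(f)\|_{L^{p}_{\mu}}\le 2\,\overline{K}\left(f;\frac{\|\overline{D}_{n,\delta,\mu}(\varphi_{x})\|_{L^{p}_{\mu}}}{2}\right)_{L^{p}_{\mu,\delta}}.$$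
   Context: $\mathcal{B}_{[0,1]}$ is the Borel $\sigma$-algebra of $[0,1]$ and $p_{n,k}(x)=\binom{n}{k}x^{k}(1-x)^{n-k}$. A set function $\mu:\mathcal{B}_{[0,1]}\to[0,+\infty]$ is monotone if $\mu(\emptyset)=0$ and $\mu(A)\le\mu(B)$ whenever $A\subset B$; submodular if $\mu(A\cup B)+\mu(A\cap B)\le\mu(A)+\mu(B)$ for all $A,B$; bounded if $\mu([0,1])<+\infty$; strictly positive if $\mu(A\cap[0,1])>0$ for every open $A\subset\mathbb{R}$ with $A\cap[0,1]\neq\emptyset$. For a monotone set function $\mu$ and a nonnegative Borel measurable $f$ on $[0,1]$, the Choquet integral is $(C)\int_{0}^{1}f\,d\mu=\int_{0}^{+\infty}\mu(\{t\in[0,1]:f(t)\ge\beta\})\,d\beta$. For a Borel measure it coincides with the Lebesgue integral. $L^{p}_{\mu}$ is the set of $\mathcal{B}_{[0,1]}$-measurable $f:[0,1]\to\mathbb{R}$ with $(C)\int_{0}^{1}|f(t)|^{p}\,d\mu(t)<+\infty$, $\|f\|_{L^{p}_{\mu}}=\left((C)\int_{0}^{1}|f(t)|^{p}\,d\mu(t)\right)^{1/p}$, and $L^{p}_{\mu,+}$ is the set of those $f\in L^{p}_{\mu}$ with values in $\mathbb{R}_{+}=[0,+\infty)$; similarly $L^{p}_{\delta}$, $\|\cdot\|_{L^p_\delta}$, $L^{p}_{\delta,+}$ for $\delta$. $C^{1}_{+}([0,1])$ is the set of nonnegative continuously differentiable functions on $[0,1]$, $\|\cdot\|_{C([0,1])}$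 is the sup norm, and for $t\ge 0$ $$\overline{K}(f;t)_{L^{p}_{\mu,\delta}}=\inf_{g\in C^{1}_{+}([0,1])}\{\|f-g\|_{L^{p}_{\mu}}+\|f-g\|_{L^{p}_{\delta}}+t\,\|g'\|_{C([0,1])}\}.$$ The quantity $\|\overline{D}_{n,\delta,\mu}(\varphi_{x})\|_{L^{p}_{\mu}}$ means the $L^{p}_{\mu}$-"norm" of the function $x\mapsto\overline{D}_{n,\delta,\mu}(\varphi_{x})(x)$. *)

theory Defs
  imports "HOL-Analysis.Analysis"
begin

text \<open>
  A function on $[0,1]$ is represented by a total function on the reals of which only the values
  on \<open>{0..1}\<close> matter.  A set function on the Borel subsets of $[0,1]$ is represented by a total
  function on sets of reals of which only the values on \<open>sets borel01\<close> matter; a Borel measure \<open>\<delta>\<close>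
  enters as the set function \<open>emeasure \<delta>\<close>.
\<close>

definition borel01 :: "real measure" where
  "borel01 = restrict_space borel {0..1}"

definition sf_monotone :: "(real set \<Rightarrow> ennreal) \<Rightarrow> bool" where
  "sf_monotone \<mu> \<longleftrightarrow> \<mu> {} = 0 \<and>
     (\<forall>A\<in>sets borel01. \<forall>B\<in>sets borel01. A \<subseteq> B \<longrightarrow> \<mu> A \<le> \<mu> B)"

definition sf_submodular :: "(real set \<Rightarrow> ennreal) \<Rightarrow> bool" where
  "sf_submodular \<mu> \<longleftrightarrow>
     (\<forall>A\<in>sets borel01. \<forall>B\<in>sets borel01. \<mu> (A \<union> B) + \<mu> (A \<inter> B) \<le> \<mu> A + \<mu> B)"

definition sf_bounded :: "(real set \<Rightarrow> ennreal) \<Rightarrow> bool" where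
  "sf_bounded \<mu> \<longleftrightarrow> \<mu> {0..1} < \<infinity>"

definition sf_strictly_positive :: "(real set \<Rightarrow> ennreal) \<Rightarrow> bool" where
  "sf_strictly_positive \<mu> \<longleftrightarrow>
     (\<forall>A. open A \<and> A \<inter> {0..1} \<noteq> {} \<longrightarrow> \<mu> (A \<inter> {0..1}) > 0)"

definition sf_continuous_incseq :: "(real set \<Rightarrow> ennreal) \<Rightarrow> bool" where
  "sf_continuous_incseq \<mu> \<longleftrightarrow>
     (\<forall>A :: nat \<Rightarrow> real set. (\<forall>n. A n \<in> sets borel01) \<and> (\<forall>n. A n \<subseteq> A (Suc n)) \<longrightarrow>
        (\<lambda>n. \<mu> (A n)) \<longlonglongrightarrow> \<mu> (\<Union>n. A n))"

definition choquet :: "(real set \<Rightarrow> ennreal) \<Rightarrow> (real \<Rightarrow> real) \<Rightarrow> ennreal" where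
  "choquet \<mu> f = (\<integral>\<^sup>+\<beta>\<in>{0..}. \<mu> {t\<in>{0..1}. f t \<ge> \<beta>} \<partial>lborel)"

definition Lp :: "real \<Rightarrow> (real set \<Rightarrow> ennreal) \<Rightarrow> (real \<Rightarrow> real) set" where
  "Lp p \<mu> = {f. f \<in> borel_measurable borel01 \<and> choquet \<mu> (\<lambda>t. \<bar>f t\<bar> powr p) < \<infinity>}"

definition Lp_plus :: "real \<Rightarrow> (real set \<Rightarrow> ennreal) \<Rightarrow> (real \<Rightarrow> real) set" where
  "Lp_plus p \<mu> = {f \<in> Lp p \<mu>. \<forall>t\<in>{0..1}. 0 \<le> f t}"

text \<open>The extended value $\infty$ keeps the norm of a function outside $L^p_\mu$ from being finite.\<close>

definition Lp_norm :: "real \<Rightarrow> (real set \<Rightarrow> ennreal) \<Rightarrow> (real \<Rightarrow> real) \<Rightarrow> ennreal" where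
  "Lp_norm p \<mu> f =
     (let I = choquet \<mu> (\<lambda>t. \<bar>f t\<bar> powr p)
      in if I = \<infinity> then \<infinity> else ennreal (enn2real I powr (1 / p)))"

text \<open>Continuous differentiability on $[0,1]$, with one-sided derivatives at the end points.\<close>

definition C1_plus :: "(real \<Rightarrow> real) set" where
  "C1_plus = {g. (\<forall>t\<in>{0..1}. 0 \<le> g t) \<and> g differentiable_on {0..1} \<and>
     continuous_on {0..1} (\<lambda>t. vector_derivative g (at t within {0..1}))}"

definition sup_norm :: "(real \<Rightarrow> real) \<Rightarrow> ennreal" where
  "sup_norm h = (SUP t\<in>{0..1}. ennreal \<bar>h t\<bar>)"

definition K_bar ::
  "real \<Rightarrow> (real set \<Rightarrow> ennreal) \<Rightarrow> (real set \<Rightarrow> ennreal) \<Rightarrow> (real \<Rightarrow> real) \<Rightarrow> ennreal \<Rightarrow> ennreal" where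
  "K_bar p \<mu> \<delta> f t =
     (INF g\<in>C1_plus. Lp_norm p \<mu> (\<lambda>s. f s - g s) + Lp_norm p \<delta> (\<lambda>s. f s - g s)
        + t * sup_norm (\<lambda>s. vector_derivative g (at s within {0..1})))"

text \<open>
  \<open>Bernstein n k\<close> is $p_{n,k}$.  For bounded \<open>\<mu> \<le> \<delta>\<close> and nonnegative \<open>f\<close> in $L^p_\delta$, $p > 1$,
  the Choquet integrals below are finite, so \<open>enn2real\<close> loses nothing.
\<close>

definition D_bar ::
  "nat \<Rightarrow> real measure \<Rightarrow> (real set \<Rightarrow> ennreal) \<Rightarrow> (real \<Rightarrow> real) \<Rightarrow> real \<Rightarrow> real" where
  "D_bar n \<delta> \<mu> f x =
     (\<Sum>k<n. Bernstein n k x *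
        ((LINT t|\<delta>. f t * Bernstein n k t) / (LINT t|\<delta>. Bernstein n k t)))
     + x ^ n * (enn2real (choquet \<mu> (\<lambda>t. f t * t ^ n)) / enn2real (choquet \<mu> (\<lambda>t. t ^ n)))"

end

theory Submission
  imports Defs
begin

text \<open>
  The operator \<open>D\<close> attaches to \<open>h\<close> the combination \<open>\<Sum>\<^sub>k p\<^sub>n\<^sub>,\<^sub>k(x) m\<^sub>k(h)\<close> of the weighted means
  \<open>m\<^sub>k(h) = (C)\<integral>h p\<^sub>n\<^sub>,\<^sub>k d\<nu>\<^sub>k / (C)\<integral>p\<^sub>n\<^sub>,\<^sub>k d\<nu>\<^sub>k\<close>, where \<open>\<nu>\<^sub>k\<close> is \<open>\<delta>\<close> for \<open>k < n\<close> and \<open>\<mu>\<close> for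
  \<open>k = n\<close>.  The Choquet integral of a submodular set function is monotone, positively homogeneous and
  subadditive (\<open>choquet_subadditive\<close>), and these three properties carry everything else.

  They give Minkowski's inequality in \<open>L\<^sup>p\<^sub>\<mu>\<close> (\<open>Minkowski_Lp_norm\<close>), Jensen's inequality
  \<open>m\<^sub>k(h)\<^sup>p \<le> m\<^sub>k(h\<^sup>p)\<close> (\<open>mean_powr_le\<close>), and \<open>\<bar>m\<^sub>k(f) - m\<^sub>k(g)\<bar> \<le> m\<^sub>k(\<bar>f - g\<bar>)\<close>.  Hence
  \<open>\<bar>D f - D g\<bar> \<le> D \<bar>f - g\<bar>\<close>, although \<open>D\<close> is not linear.

  Let \<open>g\<close> be nonnegative and continuously differentiable.  By the triangle inequality
  \<open>\<parallel>f - D f\<parallel> \<le> \<parallel>f - g\<parallel> + \<parallel>g - D g\<parallel> + \<parallel>D g - D f\<parallel>\<close> in \<open>L\<^sup>p\<^sub>\<mu>\<close>.  The middle term is at most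
  \<open>\<parallel>g'\<parallel> \<parallel>D (\<phi>\<^sub>x)\<parallel>\<close>, because \<open>D\<close> reproduces nonnegative constants and
  \<open>\<bar>g(x) - g(t)\<bar> \<le> \<parallel>g'\<parallel> \<bar>t - x\<bar>\<close> (\<open>Lp_norm_C1_minus_D_le\<close>).  The last term is at most the \<open>L\<^sup>p\<^sub>\<delta>\<close> norm
  of \<open>f - g\<close>, because \<open>D\<close> is a contraction from \<open>L\<^sup>p\<^sub>\<delta>\<close> to \<open>L\<^sup>p\<^sub>\<mu>\<close>: after Jensen's inequality, the
  domination \<open>\<mu> \<le> \<nu>\<^sub>k \<le> \<delta>\<close> cancels the denominators and the Bernstein polynomials sum to \<open>1\<close>
  (\<open>Lp_norm_D_le\<close>).  The sum of the three bounds is at most twice the quantity whose infimum over \<open>g\<close>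
  is the K-functional.

  Subadditivity itself is a statement about level sets.  For integer-valued functions it is proved by
  adding indicators one at a time and telescoping the submodularity inequalities; general functions
  differ from their integer parts by a bounded amount, which homogeneity makes negligible.
\<close>

section \<open>Choquet integrals of a submodular set function\<close>

lemma space_borel01 [simp]: "space borel01 = {0..1}"
  by (simp add: borel01_def space_restrict_space)

lemma superlevel_sets_borel01:
  assumes "f \<in> borel_measurable borel01"
  shows "{t\<in>{0..1}. f t \<ge> (c::real)} \<in> sets borel01"
  using assms by (simp add: borel_measurable_iff_ge)

lemma nat_superlevel_sets_borel01:
  fixes H :: "real \<Rightarrow> nat"
  assumes [measurable]: "H \<in> measurable borel01 (count_space UNIV)"
  shows "{t\<in>{0..1}. H t \<ge> i} \<in> sets borel01"
proof -
  have "{t \<in> space borel01. H t \<ge> i} \<in> sets borel01"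
    by measurable
  then show ?thesis by simp
qed

lemma Suc_le_nat_floor_iff: "Suc i \<le> nat \<lfloor>x\<rfloor> \<longleftrightarrow> real (Suc i) \<le> x"
  by linarith

locale submodular_capacity =
  fixes \<nu> :: "real set \<Rightarrow> ennreal"
  assumes capacity_monotone: "sf_monotone \<nu>"
    and capacity_submodular: "sf_submodular \<nu>"
    and capacity_bounded: "sf_bounded \<nu>"
begin

lemma capacity_mono: "A \<in> sets borel01 \<Longrightarrow> B \<in> sets borel01 \<Longrightarrow> A \<subseteq> B \<Longrightarrow> \<nu> A \<le> \<nu> B"
  using capacity_monotone by (auto simp: sf_monotone_def)

lemma capacity_empty [simp]: "\<nu> {} = 0"
  using capacity_monotone by (auto simp: sf_monotone_def)

lemma capacity_le_total: "A \<in> sets borel01 \<Longrightarrow> \<nu> A \<le> \<nu> {0..1}"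
  by (metis capacity_mono sets.sets_into_space sets.top space_borel01)

lemma capacity_total_finite: "\<nu> {0..1} < \<infinity>"
  using capacity_bounded by (simp add: sf_bounded_def)

text \<open>
  The tail of \<open>f\<close> under \<open>\<nu>\<close> is the integrand in the definition of the Choquet integral.  It is a
  monotone function of the level, hence Borel measurable although \<open>\<nu>\<close> is not a measure.
\<close>

definition tail :: "(real \<Rightarrow> real) \<Rightarrow> real \<Rightarrow> ennreal" where
  "tail f \<beta> = \<nu> {t\<in>{0..1}. f t \<ge> \<beta>}"

lemma choquet_eq_tail: "choquet \<nu> f = (\<integral>\<^sup>+\<beta>\<in>{0..}. tail f \<beta> \<partial>lborel)"
  unfolding choquet_def tail_def ..

lemma tail_le_total:
  assumes "f \<in> borel_measurable borel01"
  shows "tail f \<beta> \<le> \<nu> {0..1}"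
  unfolding tail_def by (intro capacity_le_total superlevel_sets_borel01 assms)

lemma tail_mono:
  assumes "f \<in> borel_measurable borel01" "g \<in> borel_measurable borel01"
    and "\<And>t. t \<in> {0..1} \<Longrightarrow> f t \<ge> \<beta> \<Longrightarrow> g t \<ge> \<gamma>"
  shows "tail f \<beta> \<le> tail g \<gamma>"
  unfolding tail_def using assms(3)
  by (intro capacity_mono superlevel_sets_borel01 assms(1,2)) blast

lemma tail_measurable [measurable]:
  assumes "f \<in> borel_measurable borel01"
  shows "tail f \<in> borel_measurable borel"
proof -
  define h where "h \<beta> = - enn2real (tail f \<beta>)" for \<beta>
  have fin: "tail f \<beta> < top" for \<beta>
    using le_less_trans[OF tail_le_total[OF assms] capacity_total_finite] by simp
  have "mono h"
    unfolding h_def using fin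
    by (intro monoI le_imp_neg_le enn2real_mono tail_mono assms) auto
  then have [measurable]: "h \<in> borel_measurable borel"
    by (rule borel_measurable_mono)
  have "tail f = (\<lambda>\<beta>. ennreal (- h \<beta>))"
    using fin by (simp add: h_def fun_eq_iff)
  then show ?thesis
    by simp
qed

lemma choquet_mono:
  assumes "f \<in> borel_measurable borel01" "g \<in> borel_measurable borel01"
    and "\<And>t. t \<in> {0..1} \<Longrightarrow> f t \<le> g t"
  shows "choquet \<nu> f \<le> choquet \<nu> g"
  unfolding choquet_eq_tail
  using assms by (intro nn_integral_mono mult_right_mono tail_mono) (auto intro: order_trans)

lemma choquet_const:
  assumes "0 \<le> c"
  shows "choquet \<nu> (\<lambda>_. c) = ennreal c * \<nu> {0..1}"
proof -
  have "tail (\<lambda>_. c) \<beta> = (if \<beta> \<le> c then \<nu> {0..1} else 0)" for \<beta>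
    by (simp add: tail_def del: atLeastAtMost_iff)
  then have "choquet \<nu> (\<lambda>_. c) = (\<integral>\<^sup>+\<beta>. \<nu> {0..1} * indicator {0..c} \<beta> \<partial>lborel)"
    unfolding choquet_eq_tail by (intro nn_integral_cong) (auto split: split_indicator)
  also have "\<dots> = ennreal c * \<nu> {0..1}"
    using assms by (simp add: nn_integral_cmult mult.commute)
  finally show ?thesis .
qed

lemma choquet_cmult:
  assumes f: "f \<in> borel_measurable borel01" and c: "0 \<le> c"
  shows "choquet \<nu> (\<lambda>t. c * f t) = ennreal c * choquet \<nu> f"
proof (cases "c = 0")
  case True
  then show ?thesis
    using choquet_const[of 0] by simp
next
  case False
  then have "c > 0" using c by simp
  have [measurable]: "tail (\<lambda>t. c * f t) \<in> borel_measurable borel"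
    using f by (intro tail_measurable) simp
  have tail_scale: "tail (\<lambda>t. c * f t) (c * \<beta>) = tail f \<beta>" for \<beta>
    using \<open>c > 0\<close> by (simp add: tail_def)
  have "choquet \<nu> (\<lambda>t. c * f t) =
      ennreal c * (\<integral>\<^sup>+\<beta>. tail (\<lambda>t. c * f t) (0 + c * \<beta>) * indicator {0..} (0 + c * \<beta>) \<partial>lborel)"
    unfolding choquet_eq_tail using \<open>c > 0\<close> by (subst nn_integral_real_affine[of _ c 0]) auto
  also have "\<dots> = ennreal c * choquet \<nu> f"
    unfolding choquet_eq_tail using \<open>c > 0\<close>
    by (intro arg_cong2[of _ _ _ _ "(*)"] nn_integral_cong refl)
      (auto simp: tail_scale zero_le_mult_iff split: split_indicator)
  finally show ?thesis .
qed

text \<open>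
  This is where submodularity enters.  Passing from \<open>F\<close> to \<open>F + 1\<^sub>B\<close> replaces the level set \<open>{F \<ge> i + 1}\<close>
  by its union with \<open>{F \<ge> i} \<inter> B\<close>, and the intersection of these two sets is \<open>{F \<ge> i + 1} \<inter> B\<close>.
  Submodularity therefore bounds the growth at level \<open>i + 1\<close> by
  \<open>\<nu> ({F \<ge> i} \<inter> B) - \<nu> ({F \<ge> i + 1} \<inter> B)\<close>, and these differences telescope.  Keeping the last
  term of the telescope on the left-hand side turns the argument into an induction without
  subtraction in the extended reals.
\<close>

lemma integer_levels_add_indicator:
  fixes F :: "real \<Rightarrow> nat"
  assumes F: "\<And>i. {t\<in>{0..1}. F t \<ge> i} \<in> sets borel01" and B: "B \<in> sets borel01"
  shows "(\<Sum>i<N. \<nu> {t\<in>{0..1}. F t + of_bool (t \<in> B) \<ge> Suc i}) + \<nu> ({t\<in>{0..1}. F t \<ge> N} \<inter> B)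
    \<le> (\<Sum>i<N. \<nu> {t\<in>{0..1}. F t \<ge> Suc i}) + \<nu> B"
proof (induction N)
  case 0
  have "B \<subseteq> {0..1}"
    using sets.sets_into_space[OF B] by simp
  then have "{t\<in>{0..1}. F t \<ge> 0} \<inter> B = B"
    by auto
  then show ?case by simp
next
  case (Suc N)
  define P where "P = {t\<in>{0..1}. F t \<ge> Suc N}"
  define Q where "Q = {t\<in>{0..1}. F t \<ge> N} \<inter> B"
  have "P \<in> sets borel01" "Q \<in> sets borel01"
    unfolding P_def Q_def using F B by auto
  then have *: "\<nu> (P \<union> Q) + \<nu> (P \<inter> Q) \<le> \<nu> P + \<nu> Q"
    using capacity_submodular by (auto simp: sf_submodular_def)
  have PQ: "{t\<in>{0..1}. F t + of_bool (t \<in> B) \<ge> Suc N} = P \<union> Q" "{t\<in>{0..1}. F t \<ge> Suc N} \<inter> B = P \<inter> Q"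
    unfolding P_def Q_def by (auto split: if_splits)
  have "(\<Sum>i<Suc N. \<nu> {t\<in>{0..1}. F t + of_bool (t \<in> B) \<ge> Suc i}) + \<nu> ({t\<in>{0..1}. F t \<ge> Suc N} \<inter> B)
     = (\<Sum>i<N. \<nu> {t\<in>{0..1}. F t + of_bool (t \<in> B) \<ge> Suc i}) + (\<nu> (P \<union> Q) + \<nu> (P \<inter> Q))"
    unfolding sum.lessThan_Suc PQ by (simp add: add.assoc)
  also have "\<dots> \<le> (\<Sum>i<N. \<nu> {t\<in>{0..1}. F t + of_bool (t \<in> B) \<ge> Suc i}) + (\<nu> P + \<nu> Q)"
    using * by (rule add_left_mono)
  also have "\<dots> = ((\<Sum>i<N. \<nu> {t\<in>{0..1}. F t + of_bool (t \<in> B) \<ge> Suc i}) + \<nu> Q) + \<nu> P"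
    by (simp add: ac_simps)
  also have "\<dots> \<le> ((\<Sum>i<N. \<nu> {t\<in>{0..1}. F t \<ge> Suc i}) + \<nu> B) + \<nu> P"
    using Suc unfolding Q_def by (rule add_right_mono)
  finally show ?case
    by (simp add: P_def ac_simps)
qed

text \<open>
  An integer-valued function is the sum of the indicators of its level sets, so \<open>G\<close> can be added to
  \<open>F\<close> one indicator at a time.  The truncation at \<open>M\<close> counts how many have been added; once \<open>M\<close>
  reaches \<open>N\<close> it no longer affects the first \<open>N\<close> level sets of the sum.
\<close>

lemma integer_levels_add:
  fixes F G :: "real \<Rightarrow> nat"
  assumes F: "F \<in> measurable borel01 (count_space UNIV)"
    and G: "G \<in> measurable borel01 (count_space UNIV)"
  shows "(\<Sum>i<N. \<nu> {t\<in>{0..1}. F t + G t \<ge> Suc i})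
    \<le> (\<Sum>i<N. \<nu> {t\<in>{0..1}. F t \<ge> Suc i}) + (\<Sum>i<N. \<nu> {t\<in>{0..1}. G t \<ge> Suc i})"
proof -
  note [measurable] = F G
  have *: "(\<Sum>i<N. \<nu> {t\<in>{0..1}. F t + min (G t) M \<ge> Suc i})
    \<le> (\<Sum>i<N. \<nu> {t\<in>{0..1}. F t \<ge> Suc i}) + (\<Sum>i<M. \<nu> {t\<in>{0..1}. G t \<ge> Suc i})" for M
  proof (induction M)
    case 0
    then show ?case by simp
  next
    case (Suc M)
    let ?B = "{t\<in>{0..1}. G t \<ge> Suc M}"
    have "{t\<in>{0..1}. F t + min (G t) (Suc M) \<ge> Suc i}
        = {t\<in>{0..1}. F t + min (G t) M + of_bool (t \<in> ?B) \<ge> Suc i}" for i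
      by auto
    then have "(\<Sum>i<N. \<nu> {t\<in>{0..1}. F t + min (G t) (Suc M) \<ge> Suc i})
        \<le> (\<Sum>i<N. \<nu> {t\<in>{0..1}. F t + min (G t) M + of_bool (t \<in> ?B) \<ge> Suc i})
          + \<nu> ({t\<in>{0..1}. F t + min (G t) M \<ge> N} \<inter> ?B)"
      by simp
    also have "\<dots> \<le> (\<Sum>i<N. \<nu> {t\<in>{0..1}. F t + min (G t) M \<ge> Suc i}) + \<nu> ?B"
      by (intro integer_levels_add_indicator nat_superlevel_sets_borel01) measurable
    also have "\<dots> \<le> ((\<Sum>i<N. \<nu> {t\<in>{0..1}. F t \<ge> Suc i}) + (\<Sum>i<M. \<nu> {t\<in>{0..1}. G t \<ge> Suc i})) + \<nu> ?B"
      using Suc by (rule add_right_mono)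
    finally show ?case
      by (simp add: ac_simps)
  qed
  have "{t\<in>{0..1}. F t + G t \<ge> Suc i} = {t\<in>{0..1}. F t + min (G t) N \<ge> Suc i}" if "i < N" for i
    using that by auto
  then show ?thesis
    using *[of N] by simp
qed

lemma choquet_split_unit_intervals:
  assumes f: "f \<in> borel_measurable borel01"
  shows "choquet \<nu> f = (\<Sum>i. \<integral>\<^sup>+\<beta>\<in>{real i..<real i + 1}. tail f \<beta> \<partial>lborel)"
proof -
  note [measurable] = tail_measurable[OF f]
  have U: "(\<Union>i. {real i..<real i + 1}) = {0..}"
  proof (intro set_eqI iffI)
    fix x :: real assume "x \<in> {0..}"
    then show "x \<in> (\<Union>i. {real i..<real i + 1})"
      by (intro UN_I[of "nat \<lfloor>x\<rfloor>"]) (auto simp: of_nat_nat)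
  qed auto
  have "disjoint_family (\<lambda>i. {real i..<real i + 1})"
    by (auto simp: disjoint_family_on_def)
  then show ?thesis
    unfolding choquet_eq_tail U[symmetric] by (intro nn_integral_disjoint_family) simp_all
qed

text \<open>
  This is the Choquet integral of the integer part of a nonnegative \<open>f\<close>, written as a series so that
  the combinatorics of level sets applies to it.
\<close>

definition integer_level_sum :: "(real \<Rightarrow> real) \<Rightarrow> ennreal" where
  "integer_level_sum f = (\<Sum>i. tail f (real (Suc i)))"

lemma choquet_integer_level_sum:
  assumes f: "f \<in> borel_measurable borel01"
  shows "integer_level_sum f \<le> choquet \<nu> f" "choquet \<nu> f \<le> \<nu> {0..1} + integer_level_sum f"
proof -
  let ?J = "\<lambda>i. \<integral>\<^sup>+\<beta>\<in>{real i..<real i + 1}. tail f \<beta> \<partial>lborel"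
  have const: "(\<integral>\<^sup>+\<beta>\<in>{real i..<real i + 1}. c \<partial>lborel) = c" for i and c :: ennreal
    by (simp add: nn_integral_cmult)
  have lower: "tail f (real (Suc i)) \<le> ?J i" for i
  proof -
    have "(\<integral>\<^sup>+\<beta>\<in>{real i..<real i + 1}. tail f (real (Suc i)) \<partial>lborel) \<le> ?J i"
      by (intro nn_integral_mono)
        (auto split: split_indicator intro!: tail_mono f)
    then show ?thesis by (simp only: const)
  qed
  have upper: "?J i \<le> tail f (real i)" for i
  proof -
    have "?J i \<le> (\<integral>\<^sup>+\<beta>\<in>{real i..<real i + 1}. tail f (real i) \<partial>lborel)"
      by (intro nn_integral_mono)
        (auto split: split_indicator intro!: tail_mono f)
    then show ?thesis by (simp only: const)
  qed
  show "integer_level_sum f \<le> choquet \<nu> f"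
    unfolding integer_level_sum_def choquet_split_unit_intervals[OF f]
    by (intro suminf_le lower) auto
  have "choquet \<nu> f \<le> (\<Sum>i. tail f (real i))"
    unfolding choquet_split_unit_intervals[OF f] by (intro suminf_le upper) auto
  also have "\<dots> = integer_level_sum f + tail f 0"
    unfolding integer_level_sum_def by (subst suminf_offset[where i = 1]) auto
  also have "\<dots> \<le> integer_level_sum f + \<nu> {0..1}"
    by (intro add_left_mono tail_le_total f)
  finally show "choquet \<nu> f \<le> \<nu> {0..1} + integer_level_sum f"
    by (simp add: add.commute)
qed

text \<open>
  Adding integer parts loses less than \<open>2\<close>, so \<open>{f + g \<ge> i + 1} \<subseteq> {\<lfloor>f\<rfloor> + \<lfloor>g\<rfloor> \<ge> i}\<close>: the shift by one
  level costs one additional copy of \<open>\<nu> {0..1}\<close>.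
\<close>

lemma integer_level_sum_add:
  assumes f: "f \<in> borel_measurable borel01" and g: "g \<in> borel_measurable borel01"
    and f0: "\<And>t. t \<in> {0..1} \<Longrightarrow> 0 \<le> f t" and g0: "\<And>t. t \<in> {0..1} \<Longrightarrow> 0 \<le> g t"
  shows "integer_level_sum (\<lambda>t. f t + g t) \<le> \<nu> {0..1} + (integer_level_sum f + integer_level_sum g)"
proof -
  note [measurable] = f g
  define F where "F = (\<lambda>t. nat \<lfloor>f t\<rfloor>)"
  define G where "G = (\<lambda>t. nat \<lfloor>g t\<rfloor>)"
  have F[measurable]: "F \<in> measurable borel01 (count_space UNIV)"
    and G[measurable]: "G \<in> measurable borel01 (count_space UNIV)"
    unfolding F_def G_def by measurable
  have FG: "{t \<in> {0..1}. i \<le> F t + G t} \<in> sets borel01" for i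
    by (intro nat_superlevel_sets_borel01) measurable
  have Feq: "\<nu> {t\<in>{0..1}. F t \<ge> Suc i} = tail f (real (Suc i))" for i
    unfolding F_def tail_def by (simp only: Suc_le_nat_floor_iff)
  have Geq: "\<nu> {t\<in>{0..1}. G t \<ge> Suc i} = tail g (real (Suc i))" for i
    unfolding G_def tail_def by (simp only: Suc_le_nat_floor_iff)
  have sub: "{t\<in>{0..1}. f t + g t \<ge> real (Suc i)} \<subseteq> {t\<in>{0..1}. F t + G t \<ge> i}" for i
  proof clarify
    fix t :: real assume t: "t \<in> {0..1}" "f t + g t \<ge> real (Suc i)"
    have "f t < real (F t) + 1" "g t < real (G t) + 1"
      using f0[OF t(1)] g0[OF t(1)] unfolding F_def G_def by (auto simp: of_nat_nat)
    then have "real i < real (F t + G t + 1)" using t(2) by simp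
    then show "F t + G t \<ge> i" by linarith
  qed
  have "integer_level_sum (\<lambda>t. f t + g t) \<le> (\<Sum>i. \<nu> {t\<in>{0..1}. F t + G t \<ge> i})"
    unfolding integer_level_sum_def tail_def
    by (intro suminf_le capacity_mono sub superlevel_sets_borel01 FG) auto
  also have "\<dots> = (\<Sum>i. \<nu> {t\<in>{0..1}. F t + G t \<ge> Suc i}) + \<nu> {0..1}"
    by (subst suminf_offset[where i = 1]) (simp_all del: atLeastAtMost_iff)
  also have "(\<Sum>i. \<nu> {t\<in>{0..1}. F t + G t \<ge> Suc i}) \<le> integer_level_sum f + integer_level_sum g"
  proof (rule suminf_le_const)
    fix N
    have "(\<Sum>i<N. \<nu> {t\<in>{0..1}. F t + G t \<ge> Suc i})
        \<le> (\<Sum>i<N. tail f (real (Suc i))) + (\<Sum>i<N. tail g (real (Suc i)))"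
      using integer_levels_add[OF F G] by (simp only: Feq Geq)
    also have "\<dots> \<le> integer_level_sum f + integer_level_sum g"
      unfolding integer_level_sum_def by (intro add_mono sum_le_suminf) auto
    finally show "(\<Sum>i<N. \<nu> {t\<in>{0..1}. F t + G t \<ge> Suc i}) \<le> integer_level_sum f + integer_level_sum g" .
  qed auto
  finally show ?thesis
    by (simp add: add.commute add_right_mono)
qed

text \<open>
  Comparison with the integer parts proves subadditivity up to a fixed multiple of the total mass.
  The Choquet integral is positively homogeneous, so applying this to \<open>m f\<close> and \<open>m g\<close> and dividing by
  \<open>m\<close> makes the error arbitrarily small.
\<close>

theorem choquet_subadditive:
  assumes f: "f \<in> borel_measurable borel01" and g: "g \<in> borel_measurable borel01"
    and f0: "\<And>t. t \<in> {0..1} \<Longrightarrow> 0 \<le> f t" and g0: "\<And>t. t \<in> {0..1} \<Longrightarrow> 0 \<le> g t"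
  shows "choquet \<nu> (\<lambda>t. f t + g t) \<le> choquet \<nu> f + choquet \<nu> g"
proof (cases "choquet \<nu> f + choquet \<nu> g")
  case top
  then show ?thesis by (simp only: top_greatest)
next
  case (real b)
  obtain K where K: "0 \<le> K" "\<nu> {0..1} + \<nu> {0..1} = ennreal K"
    using capacity_total_finite by (cases "\<nu> {0..1} + \<nu> {0..1}") (auto simp: top_unique)
  \<comment> \<open>The constant \<open>K\<close> collects the two rounding errors and does not depend on \<open>m\<close>.\<close>
  have up: "ennreal (real m) * choquet \<nu> (\<lambda>t. f t + g t) \<le> ennreal K + ennreal (real m) * ennreal b" for m
  proof -
    let ?f = "\<lambda>t. real m * f t" and ?g = "\<lambda>t. real m * g t"
    have mf: "?f \<in> borel_measurable borel01" and mg: "?g \<in> borel_measurable borel01"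
      and mfg: "(\<lambda>t. ?f t + ?g t) \<in> borel_measurable borel01"
      using f g by auto
    have "ennreal (real m) * choquet \<nu> (\<lambda>t. f t + g t) = choquet \<nu> (\<lambda>t. ?f t + ?g t)"
      using f g by (subst choquet_cmult[symmetric]) (auto simp: distrib_left)
    also have "\<dots> \<le> \<nu> {0..1} + integer_level_sum (\<lambda>t. ?f t + ?g t)"
      by (rule choquet_integer_level_sum(2)[OF mfg])
    also have "\<dots> \<le> \<nu> {0..1} + (\<nu> {0..1} + (integer_level_sum ?f + integer_level_sum ?g))"
      by (intro add_left_mono integer_level_sum_add mf mg) (auto simp: f0 g0)
    also have "\<dots> \<le> \<nu> {0..1} + (\<nu> {0..1} + (choquet \<nu> ?f + choquet \<nu> ?g))"
      by (intro add_mono order_refl choquet_integer_level_sum(1) mf mg)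
    also have "\<dots> = ennreal K + ennreal (real m) * ennreal b"
      using f g by (simp add: choquet_cmult K(2)[symmetric] real(2)[symmetric] distrib_left add.assoc)
    finally show ?thesis .
  qed
  show ?thesis
  proof (cases "choquet \<nu> (\<lambda>t. f t + g t)")
    case top
    then show ?thesis
      using up[of 1] by (simp add: top_unique)
  next
    case (real a)
    have "real m * a \<le> K + real m * b" for m
      using up[of m] \<open>0 \<le> a\<close> \<open>0 \<le> b\<close> K(1) unfolding real
      by (simp add: ennreal_mult[symmetric] ennreal_plus[symmetric] del: ennreal_plus)
    then have le: "real m * (a - b) \<le> K" for m
      by (simp add: algebra_simps)
    have "a \<le> b"
    proof (rule ccontr)
      assume "\<not> a \<le> b"
      then obtain m :: nat where "K < real m * (a - b)"
        using reals_Archimedean3[of "a - b"] by auto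
      with le[of m] show False by simp
    qed
    then show ?thesis
      using real \<open>choquet \<nu> f + choquet \<nu> g = ennreal b\<close> by (simp add: ennreal_leI)
  qed
qed

lemma choquet_bounded_finite:
  assumes "f \<in> borel_measurable borel01" and "\<And>t. t \<in> {0..1} \<Longrightarrow> f t \<le> c"
  shows "choquet \<nu> f < \<infinity>"
proof -
  have "choquet \<nu> f \<le> choquet \<nu> (\<lambda>_. \<bar>c\<bar>)"
    using assms by (intro choquet_mono) (auto intro: order_trans[OF _ abs_ge_self])
  also have "\<dots> = ennreal \<bar>c\<bar> * \<nu> {0..1}"
    by (rule choquet_const) simp
  also have "\<dots> < \<infinity>"
    using capacity_total_finite by (simp add: ennreal_mult_less_top)
  finally show ?thesis .
qed

lemma choquet_sum_le:
  assumes "finite I" and "\<And>i. i \<in> I \<Longrightarrow> f i \<in> borel_measurable borel01"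
    and "\<And>i t. i \<in> I \<Longrightarrow> t \<in> {0..1} \<Longrightarrow> 0 \<le> f i t"
  shows "choquet \<nu> (\<lambda>t. \<Sum>i\<in>I. f i t) \<le> (\<Sum>i\<in>I. choquet \<nu> (f i))"
  using assms
proof (induction I rule: finite_induct)
  case empty
  then show ?case
    using choquet_const[of 0] by simp
next
  case (insert j I)
  have "choquet \<nu> (\<lambda>t. \<Sum>i\<in>insert j I. f i t) = choquet \<nu> (\<lambda>t. f j t + (\<Sum>i\<in>I. f i t))"
    using insert.hyps by simp
  also have "\<dots> \<le> choquet \<nu> (f j) + choquet \<nu> (\<lambda>t. \<Sum>i\<in>I. f i t)"
    using insert.prems by (intro choquet_subadditive borel_measurable_sum sum_nonneg) auto
  also have "\<dots> \<le> choquet \<nu> (f j) + (\<Sum>i\<in>I. choquet \<nu> (f i))"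
    using insert.prems by (intro add_left_mono insert.IH) auto
  finally show ?case
    using insert.hyps by simp
qed

end

section \<open>Comparison and positivity of Choquet integrals\<close>

lemma choquet_cong:
  assumes "\<And>t. t \<in> {0..1} \<Longrightarrow> f t = g t"
  shows "choquet \<nu> f = choquet \<nu> g"
proof -
  have "{t\<in>{0..1}. f t \<ge> \<beta>} = {t\<in>{0..1}. g t \<ge> \<beta>}" for \<beta>
    using assms by auto
  then show ?thesis
    unfolding choquet_def by simp
qed

lemma choquet_capacity_mono:
  assumes "\<And>A. A \<in> sets borel01 \<Longrightarrow> \<mu> A \<le> \<nu> A" and "f \<in> borel_measurable borel01"
  shows "choquet \<mu> f \<le> choquet \<nu> f"
  unfolding choquet_def
  by (intro nn_integral_mono mult_right_mono assms superlevel_sets_borel01) auto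

lemma choquet_pos:
  assumes pos: "sf_strictly_positive \<nu>" and mono: "sf_monotone \<nu>"
    and f: "f \<in> borel_measurable borel01"
    and U: "open U" "U \<inter> {0..1} \<noteq> {}" and c: "0 < c" "\<And>t. t \<in> U \<inter> {0..1} \<Longrightarrow> c \<le> f t"
  shows "0 < choquet \<nu> f"
proof -
  have UB: "U \<inter> {0..1} \<in> sets borel01"
    unfolding borel01_def sets_restrict_space
    by (rule image_eqI[of _ _ U]) (simp_all add: Int_commute borel_open U(1))
  have "0 < ennreal c * \<nu> (U \<inter> {0..1})"
    using pos U c(1) by (auto simp: sf_strictly_positive_def ennreal_zero_less_mult_iff)
  also have "\<dots> = (\<integral>\<^sup>+\<beta>. \<nu> (U \<inter> {0..1}) * indicator {0..c} \<beta> \<partial>lborel)"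
    using c(1) by (subst nn_integral_cmult) (simp_all add: mult.commute)
  also have "\<dots> \<le> choquet \<nu> f"
    unfolding choquet_def
  proof (intro nn_integral_mono)
    fix \<beta> :: real
    have "\<nu> (U \<inter> {0..1}) \<le> \<nu> {t\<in>{0..1}. f t \<ge> \<beta>}" if "\<beta> \<le> c"
    proof -
      have "U \<inter> {0..1} \<subseteq> {t\<in>{0..1}. f t \<ge> \<beta>}"
        using c(2) that by force
      then show ?thesis
        using mono UB superlevel_sets_borel01[OF f] unfolding sf_monotone_def by blast
    qed
    then show "\<nu> (U \<inter> {0..1}) * indicator {0..c} \<beta> \<le> \<nu> {t\<in>{0..1}. f t \<ge> \<beta>} * indicator {0..} \<beta>"
      by (cases "\<beta> \<in> {0..c}") auto
  qed
  finally show ?thesis .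
qed

text \<open>
  The layer cake formula, by exchanging the order of integration over the region
  \<open>0 \<le> \<beta> \<le> f t\<close>.
\<close>

lemma choquet_emeasure:
  assumes sets: "sets \<delta> = sets borel01" and fin: "emeasure \<delta> {0..1} < \<infinity>"
    and f: "f \<in> borel_measurable borel01" and f0: "\<And>t. t \<in> {0..1} \<Longrightarrow> 0 \<le> f t"
  shows "choquet (emeasure \<delta>) f = (\<integral>\<^sup>+t. f t \<partial>\<delta>)"
proof -
  have space: "space \<delta> = {0..1}"
    using sets_eq_imp_space_eq[OF sets] by simp
  interpret finite_measure \<delta>
    using fin space by (intro finite_measureI) auto
  interpret pair_sigma_finite \<delta> lborel
    by (simp add: pair_sigma_finite_def sigma_finite_measure_axioms lborel.sigma_finite_measure_axioms)
  have [measurable]: "f \<in> borel_measurable \<delta>"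
    using f measurable_cong_sets[OF sets refl] by blast
  have "choquet (emeasure \<delta>) f = (\<integral>\<^sup>+\<beta>. (\<integral>\<^sup>+t. of_bool (0 \<le> \<beta> \<and> \<beta> \<le> f t) \<partial>\<delta>) \<partial>lborel)"
    unfolding choquet_def
  proof (intro nn_integral_cong)
    fix \<beta> :: real
    have "(\<integral>\<^sup>+t. of_bool (0 \<le> \<beta> \<and> \<beta> \<le> f t) \<partial>\<delta>)
        = (\<integral>\<^sup>+t. indicator {0..} \<beta> * indicator {t\<in>space \<delta>. \<beta> \<le> f t} t \<partial>\<delta>)"
      by (intro nn_integral_cong) (auto simp: indicator_def)
    also have "\<dots> = emeasure \<delta> {t\<in>space \<delta>. f t \<ge> \<beta>} * indicator {0..} \<beta>"
      by (subst nn_integral_cmult) (auto simp: mult.commute)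
    finally show "emeasure \<delta> {t\<in>{0..1}. f t \<ge> \<beta>} * indicator {0..} \<beta>
        = (\<integral>\<^sup>+t. of_bool (0 \<le> \<beta> \<and> \<beta> \<le> f t) \<partial>\<delta>)"
      by (simp only: space)
  qed
  also have "\<dots> = (\<integral>\<^sup>+t. (\<integral>\<^sup>+\<beta>. of_bool (0 \<le> \<beta> \<and> \<beta> \<le> f t) \<partial>lborel) \<partial>\<delta>)"
    by (intro Fubini') measurable
  also have "\<dots> = (\<integral>\<^sup>+t. f t \<partial>\<delta>)"
  proof (intro nn_integral_cong)
    fix t assume t: "t \<in> space \<delta>"
    have "(\<integral>\<^sup>+\<beta>. of_bool (0 \<le> \<beta> \<and> \<beta> \<le> f t) \<partial>lborel) = (\<integral>\<^sup>+\<beta>. indicator {0..f t} \<beta> \<partial>lborel)"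
      by (intro nn_integral_cong) (auto simp: indicator_def)
    also have "\<dots> = ennreal (f t)"
      using f0[of t] t space by simp
    finally show "(\<integral>\<^sup>+\<beta>. of_bool (0 \<le> \<beta> \<and> \<beta> \<le> f t) \<partial>lborel) = ennreal (f t)" .
  qed
  finally show ?thesis .
qed

lemma submodular_capacity_emeasure:
  assumes sets: "sets \<delta> = sets borel01" and bdd: "sf_bounded (emeasure \<delta>)"
  shows "submodular_capacity (emeasure \<delta>)"
proof
  show "sf_monotone (emeasure \<delta>)"
    unfolding sf_monotone_def by (auto intro!: emeasure_mono simp: sets)
  show "sf_submodular (emeasure \<delta>)"
    unfolding sf_submodular_def sets[symmetric]
    by (intro ballI eq_refl emeasure_Un_Int[symmetric])
qed (rule bdd)

section \<open>Convexity of powers\<close>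

text \<open>
  The graph of \<open>y \<mapsto> y\<^sup>p\<close> lies above its tangent at \<open>c\<close>.  Choosing \<open>c\<close> to be a mean value of \<open>y\<close> yields
  a Jensen inequality for every mean that is monotone, positively homogeneous and subadditive; the
  form without subtraction is the one that a merely subadditive mean can be applied to.
\<close>

lemma powr_tangent_ge:
  fixes p c y :: real
  assumes p: "p > 1" and c: "0 < c" and y: "0 \<le> y"
  shows "p * c powr (p - 1) * y \<le> y powr p + (p - 1) * c powr p"
proof -
  have "1 / p + 1 / (p / (p - 1)) = 1"
    using p by (simp add: field_simps)
  \<comment> \<open>Young's inequality for \<open>y / c\<close> and \<open>1\<close> is the tangent inequality at \<open>1\<close>.\<close>
  then have "y / c * 1 \<le> (y / c) powr p / p + 1 powr (p / (p - 1)) / (p / (p - 1))"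
    using p c y by (intro Youngs_inequality) (auto simp: field_simps)
  then have "p * (y / c) \<le> p * ((y / c) powr p / p + (p - 1) / p)"
    using p by (intro mult_left_mono) auto
  then have "p * (y / c) \<le> (y / c) powr p + (p - 1)"
    using p by (simp add: distrib_left)
  then have "c powr p * (p * (y / c)) \<le> c powr p * ((y / c) powr p + (p - 1))"
    using c by (intro mult_left_mono) auto
  moreover have "c powr p * (p * (y / c)) = p * c powr (p - 1) * y"
    using c by (simp add: powr_diff field_simps)
  moreover have "c powr p * ((y / c) powr p + (p - 1)) = y powr p + (p - 1) * c powr p"
    using c y by (simp add: powr_divide field_simps)
  ultimately show ?thesis by simp
qed

lemma powr_weighted_mean_le:
  fixes p :: real and a w :: "'a \<Rightarrow> real"
  assumes p: "p > 1" and w: "\<And>i. i \<in> I \<Longrightarrow> 0 \<le> w i" "sum w I = 1"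
    and a: "\<And>i. i \<in> I \<Longrightarrow> 0 \<le> a i"
  shows "(\<Sum>i\<in>I. w i * a i) powr p \<le> (\<Sum>i\<in>I. w i * a i powr p)"
proof -
  define c where "c = (\<Sum>i\<in>I. w i * a i)"
  have c0: "0 \<le> c"
    unfolding c_def using w a by (intro sum_nonneg) auto
  show ?thesis
  proof (cases "c = 0")
    case True
    then show ?thesis
      unfolding c_def using w(1) by (auto intro!: sum_nonneg)
  next
    case False
    then have c: "0 < c" using c0 by simp
    have "p * c powr p = p * c powr (p - 1) * c"
      using c by (simp add: powr_diff)
    also have "\<dots> = (\<Sum>i\<in>I. w i * (p * c powr (p - 1) * a i))"
      by (subst (2) c_def) (simp add: sum_distrib_left ac_simps)
    also have "\<dots> \<le> (\<Sum>i\<in>I. w i * (a i powr p + (p - 1) * c powr p))"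
      using w(1) a by (intro sum_mono mult_left_mono powr_tangent_ge p c)
    also have "\<dots> = (\<Sum>i\<in>I. w i * a i powr p) + (p - 1) * c powr p"
      using w(2) by (simp add: distrib_left sum.distrib flip: sum_distrib_right)
    finally show ?thesis
      by (simp add: c_def algebra_simps)
  qed
qed

section \<open>The $L^p$ norm of a submodular set function\<close>

text \<open>
  Norm estimates are reduced to this equivalence, which avoids taking roots of extended reals.
\<close>

lemma Lp_norm_le_iff:
  assumes p: "p > 0" and c: "0 \<le> c"
  shows "Lp_norm p \<nu> f \<le> ennreal c \<longleftrightarrow> choquet \<nu> (\<lambda>t. \<bar>f t\<bar> powr p) \<le> ennreal (c powr p)"
proof (cases "choquet \<nu> (\<lambda>t. \<bar>f t\<bar> powr p)")
  case top
  then show ?thesis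
    by (simp add: Lp_norm_def top_unique)
next
  case (real i)
  have "i powr (1 / p) \<le> c \<longleftrightarrow> i \<le> c powr p"
  proof
    assume "i powr (1 / p) \<le> c"
    then have "(i powr (1 / p)) powr p \<le> c powr p"
      using p by (intro powr_mono2) auto
    then show "i \<le> c powr p"
      using p real(1) by (simp add: powr_powr)
  next
    assume "i \<le> c powr p"
    then have "i powr (1 / p) \<le> (c powr p) powr (1 / p)"
      using p real(1) by (intro powr_mono2) auto
    then show "i powr (1 / p) \<le> c"
      using p c by (simp add: powr_powr)
  qed
  then show ?thesis
    using real c by (simp add: Lp_norm_def ennreal_le_iff)
qed

context submodular_capacity
begin

lemma Lp_norm_mono:
  assumes p: "p > 0" and f: "f \<in> borel_measurable borel01" and g: "g \<in> borel_measurable borel01"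
    and le: "\<And>t. t \<in> {0..1} \<Longrightarrow> \<bar>f t\<bar> \<le> \<bar>g t\<bar>"
  shows "Lp_norm p \<nu> f \<le> Lp_norm p \<nu> g"
proof (cases "Lp_norm p \<nu> g")
  case (real b)
  note [measurable] = f g
  have "choquet \<nu> (\<lambda>t. \<bar>f t\<bar> powr p) \<le> choquet \<nu> (\<lambda>t. \<bar>g t\<bar> powr p)"
    using p le by (intro choquet_mono powr_mono2) auto
  also have "\<dots> \<le> ennreal (b powr p)"
    using real p by (subst Lp_norm_le_iff[symmetric]) auto
  finally show ?thesis
    using real p by (simp add: Lp_norm_le_iff)
qed simp

lemma Lp_norm_cmult_le:
  assumes p: "p > 0" and f: "f \<in> borel_measurable borel01" and c: "0 \<le> c"
  shows "Lp_norm p \<nu> (\<lambda>t. c * f t) \<le> ennreal c * Lp_norm p \<nu> f"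
proof (cases "Lp_norm p \<nu> f")
  case (real b)
  note [measurable] = f
  have "choquet \<nu> (\<lambda>t. \<bar>c * f t\<bar> powr p) = choquet \<nu> (\<lambda>t. c powr p * \<bar>f t\<bar> powr p)"
    using c by (simp add: abs_mult powr_mult)
  also have "\<dots> = ennreal (c powr p) * choquet \<nu> (\<lambda>t. \<bar>f t\<bar> powr p)"
    by (intro choquet_cmult) auto
  also have "\<dots> \<le> ennreal (c powr p) * ennreal (b powr p)"
    using real p by (intro mult_left_mono) (auto simp: Lp_norm_le_iff[symmetric])
  also have "\<dots> = ennreal ((c * b) powr p)"
    using c real by (simp add: powr_mult ennreal_mult)
  finally have "Lp_norm p \<nu> (\<lambda>t. c * f t) \<le> ennreal (c * b)"
    using c real p by (simp add: Lp_norm_le_iff)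
  then show ?thesis
    using c real by (simp add: ennreal_mult)
next
  case top
  show ?thesis
  proof (cases "c = 0")
    case True
    have "choquet \<nu> (\<lambda>t. \<bar>c * f t\<bar> powr p) \<le> ennreal (0 powr p)"
      using True choquet_const[of 0] by simp
    then have "Lp_norm p \<nu> (\<lambda>t. c * f t) \<le> ennreal 0"
      using p by (subst Lp_norm_le_iff) auto
    then show ?thesis by simp
  next
    case False
    then show ?thesis
      using top c by (simp add: ennreal_mult_top)
  qed
qed

text \<open>
  For finite numbers \<open>A > \<parallel>f\<parallel>\<close> and \<open>B > \<parallel>g\<parallel>\<close>, convexity of the power function applied to the mean of
  \<open>\<bar>f\<bar> / A\<close> and \<open>\<bar>g\<bar> / B\<close> with weights \<open>A / (A + B)\<close> and \<open>B / (A + B)\<close> bounds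
  \<open>(\<bar>f + g\<bar> / (A + B))\<^sup>p\<close> by a function whose Choquet integral is at most \<open>1\<close>.
\<close>

theorem Minkowski_Lp_norm:
  assumes p: "p > 1" and f: "f \<in> borel_measurable borel01" and g: "g \<in> borel_measurable borel01"
  shows "Lp_norm p \<nu> (\<lambda>t. f t + g t) \<le> Lp_norm p \<nu> f + Lp_norm p \<nu> g"
proof (cases "Lp_norm p \<nu> f = top \<or> Lp_norm p \<nu> g = top")
  case True
  then show ?thesis by auto
next
  case False
  note [measurable] = f g
  obtain a b where a: "0 \<le> a" "Lp_norm p \<nu> f = ennreal a" and b: "0 \<le> b" "Lp_norm p \<nu> g = ennreal b"
    using False by (metis ennreal_cases)
  show ?thesis
  proof (rule ennreal_le_epsilon)
    fix e :: real assume e: "0 < e"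
    \<comment> \<open>Strict upper bounds keep the weights positive when one of the norms is zero.\<close>
    define A where "A = a + e / 2"
    define B where "B = b + e / 2"
    have A: "0 < A" and B: "0 < B"
      using a b e by (auto simp: A_def B_def)
    \<comment> \<open>The coefficients that the weighted convexity inequality produces.\<close>
    define u where "u = (A + B) powr p * (A / (A + B)) / A powr p"
    define v where "v = (A + B) powr p * (B / (A + B)) / B powr p"
    have uv0: "0 \<le> u" "0 \<le> v"
      using A B by (auto simp: u_def v_def)
    have uv: "u * A powr p + v * B powr p = (A + B) powr p"
      using A B by (simp add: u_def v_def flip: distrib_left add_divide_distrib)
    have pw: "\<bar>f t + g t\<bar> powr p \<le> u * \<bar>f t\<bar> powr p + v * \<bar>g t\<bar> powr p" for t
    proof -
      let ?x = "\<bar>f t\<bar> / A" and ?y = "\<bar>g t\<bar> / B"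
      have "(A / (A + B) * ?x + B / (A + B) * ?y) powr p
          \<le> A / (A + B) * ?x powr p + B / (A + B) * ?y powr p"
        using powr_weighted_mean_le[OF p, of "UNIV :: bool set"
            "\<lambda>i. if i then A / (A + B) else B / (A + B)" "\<lambda>i. if i then ?x else ?y"] A B
        by (simp add: UNIV_bool add.commute flip: add_divide_distrib)
      moreover have "A / (A + B) * ?x + B / (A + B) * ?y = (\<bar>f t\<bar> + \<bar>g t\<bar>) / (A + B)"
        using A B by (simp add: add_divide_distrib)
      ultimately have "((\<bar>f t\<bar> + \<bar>g t\<bar>) / (A + B)) powr p
          \<le> A / (A + B) * ?x powr p + B / (A + B) * ?y powr p"
        by simp
      then have "(A + B) powr p * ((\<bar>f t\<bar> + \<bar>g t\<bar>) / (A + B)) powr p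
          \<le> (A + B) powr p * (A / (A + B) * ?x powr p + B / (A + B) * ?y powr p)"
        by (intro mult_left_mono) auto
      moreover have "(A + B) powr p * (A / (A + B) * ?x powr p + B / (A + B) * ?y powr p)
          = u * \<bar>f t\<bar> powr p + v * \<bar>g t\<bar> powr p"
        using A B by (simp add: u_def v_def powr_divide distrib_left)
      moreover have "(A + B) powr p * ((\<bar>f t\<bar> + \<bar>g t\<bar>) / (A + B)) powr p = (\<bar>f t\<bar> + \<bar>g t\<bar>) powr p"
        using A B by (simp add: powr_divide)
      moreover have "\<bar>f t + g t\<bar> powr p \<le> (\<bar>f t\<bar> + \<bar>g t\<bar>) powr p"
        using p by (intro powr_mono2) auto
      ultimately show ?thesis by simp
    qed
    have "choquet \<nu> (\<lambda>t. \<bar>f t + g t\<bar> powr p)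
        \<le> choquet \<nu> (\<lambda>t. u * \<bar>f t\<bar> powr p + v * \<bar>g t\<bar> powr p)"
      by (intro choquet_mono pw) measurable
    also have "\<dots> \<le> choquet \<nu> (\<lambda>t. u * \<bar>f t\<bar> powr p) + choquet \<nu> (\<lambda>t. v * \<bar>g t\<bar> powr p)"
      using uv0 by (intro choquet_subadditive) auto
    also have "\<dots> = ennreal u * choquet \<nu> (\<lambda>t. \<bar>f t\<bar> powr p) + ennreal v * choquet \<nu> (\<lambda>t. \<bar>g t\<bar> powr p)"
      using uv0 by (intro arg_cong2[of _ _ _ _ "(+)"] choquet_cmult) auto
    also have "\<dots> \<le> ennreal u * ennreal (A powr p) + ennreal v * ennreal (B powr p)"
      using p A B a b e
      by (intro add_mono mult_left_mono)
        (auto simp: Lp_norm_le_iff[symmetric] A_def B_def intro!: ennreal_leI)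
    also have "\<dots> = ennreal ((A + B) powr p)"
      using uv0 uv by (simp flip: ennreal_mult ennreal_plus)
    finally have "Lp_norm p \<nu> (\<lambda>t. f t + g t) \<le> ennreal (A + B)"
      using p A B by (subst Lp_norm_le_iff) auto
    also have "A + B = a + b + e"
      by (simp add: A_def B_def)
    also have "ennreal (a + b + e) = Lp_norm p \<nu> f + Lp_norm p \<nu> g + ennreal e"
      using a b e by simp
    finally show "Lp_norm p \<nu> (\<lambda>t. f t + g t) \<le> Lp_norm p \<nu> f + Lp_norm p \<nu> g + ennreal e" .
  qed
qed

end

section \<open>Weighted means with respect to a submodular set function\<close>

definition choquet_integrable :: "(real set \<Rightarrow> ennreal) \<Rightarrow> (real \<Rightarrow> real) \<Rightarrow> bool" where
  "choquet_integrable \<nu> f \<longleftrightarrow>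
     f \<in> borel_measurable borel01 \<and> (\<forall>t\<in>{0..1}. 0 \<le> f t) \<and> choquet \<nu> f < \<infinity>"

context submodular_capacity
begin

lemma choquet_integrable_bounded:
  assumes "f \<in> borel_measurable borel01" and "\<And>t. t \<in> {0..1} \<Longrightarrow> 0 \<le> f t \<and> f t \<le> c"
  shows "choquet_integrable \<nu> f"
  unfolding choquet_integrable_def using assms choquet_bounded_finite[of f c] by auto

lemma choquet_integrable_mono:
  assumes "choquet_integrable \<nu> g" and "f \<in> borel_measurable borel01"
    and "\<And>t. t \<in> {0..1} \<Longrightarrow> 0 \<le> f t \<and> f t \<le> g t"
  shows "choquet_integrable \<nu> f"
  using assms choquet_mono[of f g] le_less_trans unfolding choquet_integrable_def by blast

lemma choquet_integrable_add:
  assumes "choquet_integrable \<nu> f" "choquet_integrable \<nu> g"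
  shows "choquet_integrable \<nu> (\<lambda>t. f t + g t)"
proof -
  have "choquet \<nu> (\<lambda>t. f t + g t) \<le> choquet \<nu> f + choquet \<nu> g"
    using assms by (intro choquet_subadditive) (auto simp: choquet_integrable_def)
  also have "\<dots> < \<infinity>"
    using assms by (simp add: choquet_integrable_def)
  finally show ?thesis
    using assms by (auto simp: choquet_integrable_def)
qed

lemma choquet_integrable_cmult:
  assumes "choquet_integrable \<nu> f" "0 \<le> c"
  shows "choquet_integrable \<nu> (\<lambda>t. c * f t)"
  using assms by (auto simp: choquet_integrable_def choquet_cmult ennreal_mult_less_top)

lemma choquet_integrable_abs_diff:
  assumes "choquet_integrable \<nu> f" "choquet_integrable \<nu> g"
  shows "choquet_integrable \<nu> (\<lambda>t. \<bar>f t - g t\<bar>)"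
proof (rule choquet_integrable_mono[OF choquet_integrable_add[OF assms]])
  show "(\<lambda>t. \<bar>f t - g t\<bar>) \<in> borel_measurable borel01"
    using assms by (auto simp: choquet_integrable_def)
  show "0 \<le> \<bar>f t - g t\<bar> \<and> \<bar>f t - g t\<bar> \<le> f t + g t" if "t \<in> {0..1}" for t
  proof -
    have "0 \<le> f t" "0 \<le> g t"
      using assms that by (auto simp: choquet_integrable_def)
    then show ?thesis by auto
  qed
qed

text \<open>
  On a space of finite total mass the exponent \<open>1\<close> is dominated by the exponent \<open>p\<close>; the explicit
  majorant \<open>f\<^sup>p + (p - 1)\<close> comes from the tangent at \<open>1\<close>.
\<close>

lemma choquet_integrable_of_powr:
  assumes p: "p > 1" and f: "f \<in> borel_measurable borel01" and f0: "\<And>t. t \<in> {0..1} \<Longrightarrow> 0 \<le> f t"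
    and fp: "choquet_integrable \<nu> (\<lambda>t. f t powr p)"
  shows "choquet_integrable \<nu> f"
proof (rule choquet_integrable_mono[OF choquet_integrable_add[OF fp]])
  show "choquet_integrable \<nu> (\<lambda>_. p - 1)"
    using p by (intro choquet_integrable_bounded[of _ "p - 1"]) auto
  fix t :: real assume t: "t \<in> {0..1}"
  have "f t \<le> p * f t"
    using p f0[OF t] by (simp add: mult_le_cancel_right1)
  also have "\<dots> \<le> f t powr p + (p - 1)"
    using powr_tangent_ge[OF p, of 1 "f t"] f0[OF t] by simp
  finally show "0 \<le> f t \<and> f t \<le> f t powr p + (p - 1)"
    using f0[OF t] by simp
qed (rule f)

end

text \<open>
  For \<open>w = p\<^sub>n\<^sub>,\<^sub>k\<close> these quotients are the coefficients of the Bernstein-Durrmeyer-Choquet operator, both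
  for the measure \<open>\<delta>\<close> and for the set function \<open>\<mu>\<close>.
\<close>

definition weighted_mean :: "(real set \<Rightarrow> ennreal) \<Rightarrow> (real \<Rightarrow> real) \<Rightarrow> (real \<Rightarrow> real) \<Rightarrow> real" where
  "weighted_mean \<nu> w f = enn2real (choquet \<nu> (\<lambda>t. f t * w t)) / enn2real (choquet \<nu> w)"

locale weighted_capacity = submodular_capacity +
  fixes w :: "real \<Rightarrow> real"
  assumes weight_measurable [measurable]: "w \<in> borel_measurable borel01"
    and weight_nonneg: "\<And>t. t \<in> {0..1} \<Longrightarrow> 0 \<le> w t"
    and weight_le_1: "\<And>t. t \<in> {0..1} \<Longrightarrow> w t \<le> 1"
    and weight_pos: "0 < choquet \<nu> w"
begin

abbreviation "mean \<equiv> weighted_mean \<nu> w"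

lemma choquet_weight_finite: "choquet \<nu> w < \<infinity>"
  using weight_le_1 by (intro choquet_bounded_finite) auto

lemma total_weight_pos: "0 < enn2real (choquet \<nu> w)"
  using weight_pos choquet_weight_finite by (simp add: enn2real_positive_iff)

lemma choquet_integrable_weighted:
  assumes "choquet_integrable \<nu> f"
  shows "choquet_integrable \<nu> (\<lambda>t. f t * w t)"
proof (rule choquet_integrable_mono[OF assms])
  show "(\<lambda>t. f t * w t) \<in> borel_measurable borel01"
    using assms by (auto simp: choquet_integrable_def)
  show "0 \<le> f t * w t \<and> f t * w t \<le> f t" if "t \<in> {0..1}" for t
    using assms that weight_nonneg[OF that] weight_le_1[OF that]
    by (auto simp: choquet_integrable_def mult_left_le)
qed

text \<open>
  Multiplying back by the total weight.  The identity holds in the extended reals because both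
  integrals are finite, so that \<open>enn2real\<close> loses nothing.
\<close>

lemma mean_times_weight:
  assumes "choquet_integrable \<nu> f"
  shows "ennreal (mean f) * choquet \<nu> w = choquet \<nu> (\<lambda>t. f t * w t)"
proof -
  have fin: "choquet \<nu> (\<lambda>t. f t * w t) < top"
    using choquet_integrable_weighted[OF assms] by (simp add: choquet_integrable_def)
  have "ennreal (mean f) * choquet \<nu> w = ennreal (mean f) * ennreal (enn2real (choquet \<nu> w))"
    using choquet_weight_finite by simp
  also have "\<dots> = ennreal (enn2real (choquet \<nu> (\<lambda>t. f t * w t)))"
    using total_weight_pos by (simp add: weighted_mean_def flip: ennreal_mult)
  finally show ?thesis
    using fin by simp
qed

lemma mean_nonneg: "0 \<le> mean f"
  by (simp add: weighted_mean_def)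

lemma mean_mono:
  assumes f: "choquet_integrable \<nu> f" and g: "choquet_integrable \<nu> g"
    and "\<And>t. t \<in> {0..1} \<Longrightarrow> f t \<le> g t"
  shows "mean f \<le> mean g"
  unfolding weighted_mean_def
  using choquet_integrable_weighted[OF f] choquet_integrable_weighted[OF g] assms(3) weight_nonneg
  by (intro divide_right_mono enn2real_mono choquet_mono)
    (auto simp: choquet_integrable_def intro!: mult_right_mono)

lemma mean_add_le:
  assumes f: "choquet_integrable \<nu> f" and g: "choquet_integrable \<nu> g"
  shows "mean (\<lambda>t. f t + g t) \<le> mean f + mean g"
proof -
  note fw = choquet_integrable_weighted[OF f] and gw = choquet_integrable_weighted[OF g]
  have "choquet \<nu> (\<lambda>t. f t * w t + g t * w t)
      \<le> choquet \<nu> (\<lambda>t. f t * w t) + choquet \<nu> (\<lambda>t. g t * w t)"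
    using fw gw by (intro choquet_subadditive) (auto simp: choquet_integrable_def)
  then have "enn2real (choquet \<nu> (\<lambda>t. f t * w t + g t * w t))
      \<le> enn2real (choquet \<nu> (\<lambda>t. f t * w t) + choquet \<nu> (\<lambda>t. g t * w t))"
    using fw gw by (intro enn2real_mono) (auto simp: choquet_integrable_def)
  also have "\<dots> = enn2real (choquet \<nu> (\<lambda>t. f t * w t)) + enn2real (choquet \<nu> (\<lambda>t. g t * w t))"
    using fw gw by (intro enn2real_plus) (auto simp: choquet_integrable_def)
  finally show ?thesis
    using total_weight_pos
    by (simp add: weighted_mean_def distrib_right divide_right_mono flip: add_divide_distrib)
qed

lemma mean_cmult:
  assumes "choquet_integrable \<nu> f" "0 \<le> c"
  shows "mean (\<lambda>t. c * f t) = c * mean f"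
proof -
  have "choquet \<nu> (\<lambda>t. c * (f t * w t)) = ennreal c * choquet \<nu> (\<lambda>t. f t * w t)"
    using choquet_integrable_weighted[OF assms(1)] assms(2)
    by (intro choquet_cmult) (auto simp: choquet_integrable_def)
  then show ?thesis
    using assms(2) by (simp add: weighted_mean_def mult.assoc enn2real_mult)
qed

lemma mean_const:
  assumes "0 \<le> c"
  shows "mean (\<lambda>_. c) = c"
  using assms total_weight_pos by (simp add: weighted_mean_def choquet_cmult enn2real_mult)

text \<open>
  A subadditive monotone mean satisfies \<open>mean f \<le> mean g + mean \<bar>f - g\<bar>\<close>, which substitutes for
  linearity.
\<close>

lemma abs_mean_diff_le:
  assumes f: "choquet_integrable \<nu> f" and g: "choquet_integrable \<nu> g"
  shows "\<bar>mean f - mean g\<bar> \<le> mean (\<lambda>t. \<bar>f t - g t\<bar>)"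
proof -
  have one: "mean f \<le> mean g + mean (\<lambda>t. \<bar>f t - g t\<bar>)"
    if f: "choquet_integrable \<nu> f" and g: "choquet_integrable \<nu> g" for f g
  proof -
    note d = choquet_integrable_abs_diff[OF f g]
    have "mean f \<le> mean (\<lambda>t. g t + \<bar>f t - g t\<bar>)"
      by (intro mean_mono f choquet_integrable_add g d) auto
    also have "\<dots> \<le> mean g + mean (\<lambda>t. \<bar>f t - g t\<bar>)"
      by (intro mean_add_le g d)
    finally show ?thesis .
  qed
  show ?thesis
    using one[OF f g] one[OF g f] by (simp add: abs_minus_commute abs_le_iff)
qed

text \<open>
  Jensen's inequality for a subadditive mean: the tangent inequality at \<open>c = mean f\<close>, to which the
  mean is applied.
\<close>

lemma mean_powr_le:
  assumes p: "p > 1" and f: "choquet_integrable \<nu> f" and fp: "choquet_integrable \<nu> (\<lambda>t. f t powr p)"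
  shows "mean f powr p \<le> mean (\<lambda>t. f t powr p)"
proof (cases "mean f = 0")
  case True
  then show ?thesis by (simp add: mean_nonneg)
next
  case False
  define c where "c = mean f"
  have c: "0 < c"
    using False mean_nonneg[of f] by (simp add: c_def)
  have const: "choquet_integrable \<nu> (\<lambda>_. (p - 1) * c powr p)"
    using p by (intro choquet_integrable_bounded) auto
  have "p * c powr p = p * c powr (p - 1) * mean f"
    using c by (simp add: powr_diff c_def)
  also have "\<dots> = mean (\<lambda>t. p * c powr (p - 1) * f t)"
    using p by (intro mean_cmult[symmetric] f) auto
  also have "\<dots> \<le> mean (\<lambda>t. f t powr p + (p - 1) * c powr p)"
    using p c f
    by (intro mean_mono choquet_integrable_cmult choquet_integrable_add const fp powr_tangent_ge)
      (auto simp: choquet_integrable_def)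
  also have "\<dots> \<le> mean (\<lambda>t. f t powr p) + (p - 1) * c powr p"
    using mean_add_le[OF fp const] p by (simp add: mean_const)
  finally show ?thesis
    by (simp add: c_def algebra_simps)
qed

end

section \<open>Bernstein polynomials and continuously differentiable functions\<close>

lemma borel_measurable_borel01: "f \<in> borel_measurable borel \<Longrightarrow> f \<in> borel_measurable borel01"
  unfolding borel01_def by (rule measurable_restrict_space1)

lemma Bernstein_measurable [measurable]: "Bernstein n k \<in> borel_measurable borel01"
  unfolding Bernstein_def by (intro borel_measurable_borel01) measurable

lemma Bernstein_le_1:
  assumes "x \<in> {0..1}" "k \<le> n"
  shows "Bernstein n k x \<le> 1"
proof -
  have "Bernstein n k x \<le> (\<Sum>k\<le>n. Bernstein n k x)"
    using assms by (intro member_le_sum) (auto simp: Bernstein_nonneg)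
  then show ?thesis by simp
qed

text \<open>
  A lower bound on an open interval, so that strict positivity of a set function makes the total
  weight of every Bernstein polynomial positive.
\<close>

lemma Bernstein_ge:
  assumes "x \<in> {1/4<..<3/4}" "k \<le> n"
  shows "(1/4) ^ n \<le> Bernstein n k x"
proof -
  have "(1/4 :: real) ^ n = 1 * (1/4) ^ k * (1/4) ^ (n - k)"
    using assms(2) by (simp flip: power_add)
  also have "\<dots> \<le> real (n choose k) * x ^ k * (1 - x) ^ (n - k)"
    using assms by (intro mult_mono power_mono) (auto simp: Suc_le_eq)
  finally show ?thesis
    by (simp add: Bernstein_def)
qed

lemma weighted_capacity_Bernstein:
  assumes "submodular_capacity \<nu>" "sf_strictly_positive \<nu>" "k \<le> n"
  shows "weighted_capacity \<nu> (Bernstein n k)"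
proof -
  interpret submodular_capacity \<nu> by fact
  show ?thesis
  proof
    have "\<exists>x. x \<in> {1/4<..<3/4} \<inter> {0..1::real}"
      by (rule exI[of _ "1/2"]) simp
    then show "0 < choquet \<nu> (Bernstein n k)"
      using assms(2,3) Bernstein_ge[of _ k n]
      by (intro choquet_pos[of \<nu> _ "{1/4<..<3/4}" "(1/4) ^ n"] capacity_monotone) auto
  qed (use assms(3) in \<open>auto intro!: Bernstein_nonneg Bernstein_le_1\<close>)
qed

text \<open>
  By compactness the sup norm of the derivative is finite, and by the mean value theorem it is a
  Lipschitz constant.
\<close>

lemma C1_plus_Lipschitz:
  assumes g: "g \<in> C1_plus"
  obtains M where "0 \<le> M" "sup_norm (\<lambda>s. vector_derivative g (at s within {0..1})) = ennreal M"
    and "\<And>x t. x \<in> {0..1} \<Longrightarrow> t \<in> {0..1} \<Longrightarrow> \<bar>g x - g t\<bar> \<le> M * \<bar>t - x\<bar>"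
proof -
  define d where "d s = vector_derivative g (at s within {0..1})" for s
  have diff: "g differentiable_on {0..1}" and cont: "continuous_on {0..1} d"
    using g unfolding C1_plus_def d_def by auto
  have "compact (d ` {0..1})"
    by (intro compact_continuous_image cont) auto
  then obtain B where B: "\<And>t. t \<in> {0..1} \<Longrightarrow> \<bar>d t\<bar> \<le> B"
    using compact_imp_bounded bounded_iff by (metis imageI real_norm_def)
  have "sup_norm d \<le> ennreal B"
    unfolding sup_norm_def using B by (intro SUP_least ennreal_leI) auto
  then obtain M where M: "0 \<le> M" "sup_norm d = ennreal M"
    by (cases "sup_norm d") (auto simp: top_unique)
  have dM: "\<bar>d t\<bar> \<le> M" if "t \<in> {0..1}" for t
  proof -
    have "ennreal \<bar>d t\<bar> \<le> ennreal M"
      unfolding M(2)[symmetric] sup_norm_def using that by (rule SUP_upper)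
    then show ?thesis using M(1) by simp
  qed
  have deriv: "(g has_field_derivative d t) (at t within {0..1})" if "t \<in> {0..1}" for t
    using diff that
    unfolding differentiable_on_def has_real_derivative_iff_has_vector_derivative d_def
    by (simp add: vector_derivative_works[symmetric])
  have lip: "\<bar>g x - g t\<bar> \<le> M * \<bar>t - x\<bar>" if "x \<in> {0..1}" "t \<in> {0..1}" for x t
    using field_differentiable_bound[of "{0..1}" g d M x t] deriv dM that
    by (simp add: abs_minus_commute)
  show thesis
    using that[OF M(1) _ lip] M(2) unfolding d_def by simp
qed

section \<open>The Bernstein-Durrmeyer-Choquet operator\<close>

locale bernstein_durrmeyer_choquet =
  fixes \<mu> :: "real set \<Rightarrow> ennreal" and \<delta> :: "real measure" and n :: nat
  assumes capacity: "submodular_capacity \<mu>" and positive: "sf_strictly_positive \<mu>"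
    and sets_measure: "sets \<delta> = sets borel01"
    and measure_bounded: "sf_bounded (emeasure \<delta>)"
    and measure_positive: "sf_strictly_positive (emeasure \<delta>)"
    and dominated: "\<And>A. A \<in> sets borel01 \<Longrightarrow> \<mu> A \<le> emeasure \<delta> A"
begin

sublocale \<mu>: submodular_capacity \<mu>
  by (rule capacity)

sublocale \<delta>: submodular_capacity "emeasure \<delta>"
  by (rule submodular_capacity_emeasure[OF sets_measure measure_bounded])

text \<open>
  All summands of the operator are weighted means; the last one uses \<open>\<mu>\<close> and the others use \<open>\<delta>\<close>.
  Naming the set function that belongs to \<open>k\<close> removes this case distinction from the estimates, which
  only need \<open>\<mu> \<le> \<nu> k \<le> \<delta>\<close>.
\<close>

definition \<nu> :: "nat \<Rightarrow> real set \<Rightarrow> ennreal" where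
  "\<nu> k = (if k < n then emeasure \<delta> else \<mu>)"

definition coefficient :: "nat \<Rightarrow> (real \<Rightarrow> real) \<Rightarrow> real" where
  "coefficient k = weighted_mean (\<nu> k) (Bernstein n k)"

definition D :: "(real \<Rightarrow> real) \<Rightarrow> real \<Rightarrow> real" where
  "D h x = (\<Sum>k\<le>n. Bernstein n k x * coefficient k h)"

lemma weighted_capacity_\<nu>: "k \<le> n \<Longrightarrow> weighted_capacity (\<nu> k) (Bernstein n k)"
  unfolding \<nu>_def
  using weighted_capacity_Bernstein[OF capacity positive]
    weighted_capacity_Bernstein[OF \<delta>.submodular_capacity_axioms measure_positive] by simp

lemma choquet_\<mu>_le_\<nu>: "f \<in> borel_measurable borel01 \<Longrightarrow> choquet \<mu> f \<le> choquet (\<nu> k) f"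
  by (intro choquet_capacity_mono) (auto simp: \<nu>_def dominated)

lemma choquet_\<nu>_le_\<delta>: "f \<in> borel_measurable borel01 \<Longrightarrow> choquet (\<nu> k) f \<le> choquet (emeasure \<delta>) f"
  by (intro choquet_capacity_mono) (auto simp: \<nu>_def dominated)

lemma choquet_integrable_\<nu>:
  assumes "choquet_integrable (emeasure \<delta>) f"
  shows "choquet_integrable (\<nu> k) f"
  using assms choquet_\<nu>_le_\<delta>[of f k] le_less_trans unfolding choquet_integrable_def by blast

lemma choquet_emeasure_\<delta>:
  assumes "f \<in> borel_measurable borel01" "\<And>t. t \<in> {0..1} \<Longrightarrow> 0 \<le> f t"
  shows "choquet (emeasure \<delta>) f = (\<integral>\<^sup>+t. f t \<partial>\<delta>)"
  using assms measure_bounded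
  by (intro choquet_emeasure sets_measure) (auto simp: sf_bounded_def)

text \<open>
  The Bochner integrals of nonnegative functions with respect to \<open>\<delta>\<close> are Choquet integrals with
  respect to \<open>emeasure \<delta>\<close>, and \<open>p\<^sub>n\<^sub>,\<^sub>n(t) = t\<^sup>n\<close>.
\<close>

lemma D_bar_eq_D:
  assumes f: "f \<in> borel_measurable borel01" and f0: "\<And>t. t \<in> {0..1} \<Longrightarrow> 0 \<le> f t"
  shows "D_bar n \<delta> \<mu> f = D f"
proof
  fix x
  have space: "space \<delta> = {0..1}"
    using sets_eq_imp_space_eq[OF sets_measure] by simp
  have LINT: "(LINT t|\<delta>. g t) = enn2real (choquet (emeasure \<delta>) g)"
    if "g \<in> borel_measurable borel01" "\<And>t. t \<in> {0..1} \<Longrightarrow> 0 \<le> g t" for g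
  proof -
    have "g \<in> borel_measurable \<delta>"
      using that(1) measurable_cong_sets[OF sets_measure refl] by blast
    then have "(LINT t|\<delta>. g t) = enn2real (\<integral>\<^sup>+t. g t \<partial>\<delta>)"
      using that(2) by (intro integral_eq_nn_integral AE_I2) (simp_all add: space)
    then show ?thesis
      using choquet_emeasure_\<delta>[OF that] by simp
  qed
  have LINT_f: "(LINT t|\<delta>. f t * Bernstein n k t) = enn2real (choquet (emeasure \<delta>) (\<lambda>t. f t * Bernstein n k t))"
    and LINT_1: "(LINT t|\<delta>. Bernstein n k t) = enn2real (choquet (emeasure \<delta>) (Bernstein n k))" for k
    using f f0 by (auto intro!: LINT mult_nonneg_nonneg Bernstein_nonneg)
  have coefficient_lt:
    "coefficient k f = (LINT t|\<delta>. f t * Bernstein n k t) / (LINT t|\<delta>. Bernstein n k t)" if "k < n" for k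
    using that unfolding LINT_f LINT_1 by (simp add: coefficient_def weighted_mean_def \<nu>_def)
  have "Bernstein n n = (\<lambda>t. t ^ n)"
    by (simp add: Bernstein_def fun_eq_iff)
  then show "D_bar n \<delta> \<mu> f x = D f x"
    unfolding D_bar_def D_def
    by (simp add: coefficient_lt lessThan_Suc_atMost[symmetric] coefficient_def[of n] weighted_mean_def \<nu>_def)
qed

lemma D_measurable [measurable]: "D h \<in> borel_measurable borel01"
  unfolding D_def by measurable

lemma coefficient_nonneg: "0 \<le> coefficient k h"
  by (simp add: coefficient_def weighted_mean_def)

lemma D_nonneg: "x \<in> {0..1} \<Longrightarrow> 0 \<le> D h x"
  unfolding D_def by (intro sum_nonneg mult_nonneg_nonneg Bernstein_nonneg coefficient_nonneg) auto

text \<open>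
  The coefficients are subadditive and the Bernstein polynomials are nonnegative on \<open>[0,1]\<close>.
\<close>

lemma abs_D_diff_le:
  assumes f: "choquet_integrable (emeasure \<delta>) f" and g: "choquet_integrable (emeasure \<delta>) g"
    and x: "x \<in> {0..1}"
  shows "\<bar>D f x - D g x\<bar> \<le> D (\<lambda>t. \<bar>f t - g t\<bar>) x"
proof -
  have "\<bar>D f x - D g x\<bar> = \<bar>\<Sum>k\<le>n. Bernstein n k x * (coefficient k f - coefficient k g)\<bar>"
    by (simp add: D_def sum_subtractf right_diff_distrib)
  also have "\<dots> \<le> (\<Sum>k\<le>n. \<bar>Bernstein n k x * (coefficient k f - coefficient k g)\<bar>)"
    by (rule sum_abs)
  also have "\<dots> = (\<Sum>k\<le>n. Bernstein n k x * \<bar>coefficient k f - coefficient k g\<bar>)"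
    using x by (simp add: abs_mult Bernstein_nonneg)
  also have "\<dots> \<le> D (\<lambda>t. \<bar>f t - g t\<bar>) x"
    unfolding D_def
  proof (intro sum_mono mult_left_mono)
    fix k assume "k \<in> {..n}"
    then interpret weighted_capacity "\<nu> k" "Bernstein n k"
      by (intro weighted_capacity_\<nu>) simp
    show "\<bar>coefficient k f - coefficient k g\<bar> \<le> coefficient k (\<lambda>t. \<bar>f t - g t\<bar>)"
      unfolding coefficient_def by (intro abs_mean_diff_le choquet_integrable_\<nu> f g)
  qed (use x in \<open>auto intro: Bernstein_nonneg\<close>)
  finally show ?thesis .
qed

lemma D_mono:
  assumes "choquet_integrable (emeasure \<delta>) f" "choquet_integrable (emeasure \<delta>) g"
    and "\<And>t. t \<in> {0..1} \<Longrightarrow> f t \<le> g t" and x: "x \<in> {0..1}"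
  shows "D f x \<le> D g x"
  unfolding D_def
proof (intro sum_mono mult_left_mono)
  fix k assume "k \<in> {..n}"
  then interpret weighted_capacity "\<nu> k" "Bernstein n k"
    by (intro weighted_capacity_\<nu>) simp
  show "coefficient k f \<le> coefficient k g"
    unfolding coefficient_def by (intro mean_mono choquet_integrable_\<nu> assms)
qed (use x in \<open>auto intro: Bernstein_nonneg\<close>)

lemma D_cmult:
  assumes "choquet_integrable (emeasure \<delta>) f" "0 \<le> c"
  shows "D (\<lambda>t. c * f t) x = c * D f x"
proof -
  have "coefficient k (\<lambda>t. c * f t) = c * coefficient k f" if "k \<le> n" for k
  proof -
    interpret weighted_capacity "\<nu> k" "Bernstein n k"
      using that by (rule weighted_capacity_\<nu>)
    show ?thesis
      unfolding coefficient_def by (intro mean_cmult choquet_integrable_\<nu> assms)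
  qed
  then show ?thesis
    by (simp add: D_def sum_distrib_left ac_simps)
qed

lemma D_const:
  assumes "0 \<le> c"
  shows "D (\<lambda>_. c) x = c"
proof -
  have "coefficient k (\<lambda>_. c) = c" if "k \<le> n" for k
  proof -
    interpret weighted_capacity "\<nu> k" "Bernstein n k"
      using that by (rule weighted_capacity_\<nu>)
    show ?thesis
      unfolding coefficient_def by (intro mean_const assms)
  qed
  then show ?thesis
    by (simp add: D_def flip: sum_distrib_right)
qed

lemma choquet_integrable_distance:
  "choquet_integrable (emeasure \<delta>) (\<lambda>t. \<bar>t - x\<bar>)"
proof (rule \<delta>.choquet_integrable_bounded)
  show "(\<lambda>t. \<bar>t - x\<bar>) \<in> borel_measurable borel01"
    by (intro borel_measurable_borel01) measurable
  show "0 \<le> \<bar>t - x\<bar> \<and> \<bar>t - x\<bar> \<le> 1 + \<bar>x\<bar>" if "t \<in> {0..1}" for t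
    using that by auto
qed

text \<open>
  In \<open>D (\<phi>\<^sub>x) x\<close> the coefficients themselves depend on \<open>x\<close>, so this function is not a polynomial.  Each
  coefficient is \<open>1\<close>-Lipschitz in \<open>x\<close> because \<open>\<bar>\<bar>t - x\<bar> - \<bar>t - y\<bar>\<bar> \<le> \<bar>x - y\<bar>\<close>.
\<close>

lemma D_distance_measurable: "(\<lambda>x. D (\<lambda>t. \<bar>t - x\<bar>) x) \<in> borel_measurable borel01"
proof -
  have "(\<lambda>x. coefficient k (\<lambda>t. \<bar>t - x\<bar>)) \<in> borel_measurable borel01" if "k \<le> n" for k
  proof -
    interpret weighted_capacity "\<nu> k" "Bernstein n k"
      using that by (rule weighted_capacity_\<nu>)
    have "\<bar>coefficient k (\<lambda>t. \<bar>t - x\<bar>) - coefficient k (\<lambda>t. \<bar>t - y\<bar>)\<bar> \<le> \<bar>x - y\<bar>" for x y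
    proof -
      note ix = choquet_integrable_\<nu>[OF choquet_integrable_distance[of x], of k]
        and iy = choquet_integrable_\<nu>[OF choquet_integrable_distance[of y], of k]
      have "\<bar>coefficient k (\<lambda>t. \<bar>t - x\<bar>) - coefficient k (\<lambda>t. \<bar>t - y\<bar>)\<bar>
          \<le> coefficient k (\<lambda>t. \<bar>\<bar>t - x\<bar> - \<bar>t - y\<bar>\<bar>)"
        unfolding coefficient_def by (intro abs_mean_diff_le ix iy)
      also have "\<dots> \<le> coefficient k (\<lambda>_. \<bar>x - y\<bar>)"
        unfolding coefficient_def
        by (intro mean_mono choquet_integrable_abs_diff ix iy
            choquet_integrable_bounded[of _ "\<bar>x - y\<bar>"]) auto
      also have "\<dots> = \<bar>x - y\<bar>"
        unfolding coefficient_def by (intro mean_const) simp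
      finally show ?thesis .
    qed
    then have "1-lipschitz_on UNIV (\<lambda>x. coefficient k (\<lambda>t. \<bar>t - x\<bar>))"
      by (intro lipschitz_onI) (auto simp: dist_real_def)
    then have "continuous_on UNIV (\<lambda>x. coefficient k (\<lambda>t. \<bar>t - x\<bar>))"
      by (rule lipschitz_on_continuous_on)
    then show ?thesis
      by (intro borel_measurable_borel01 borel_measurable_continuous_onI)
  qed
  then show ?thesis
    unfolding D_def by (intro borel_measurable_sum borel_measurable_times) auto
qed

text \<open>
  The central estimate: the operator is a contraction from \<open>L\<^sup>p\<^sub>\<delta>\<close> to \<open>L\<^sup>p\<^sub>\<mu>\<close>.  Jensen's inequality is used
  twice, for the convex combination \<open>\<Sum>\<^sub>k p\<^sub>n\<^sub>,\<^sub>k(x)\<close> and for each weighted mean.  Integrating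
  \<open>p\<^sub>n\<^sub>,\<^sub>k\<close> against \<open>\<mu> \<le> \<nu> k\<close> cancels the denominator of the \<open>k\<close>-th mean, and what remains are the
  integrals of \<open>h\<^sup>p p\<^sub>n\<^sub>,\<^sub>k\<close> with respect to \<open>\<nu> k \<le> \<delta>\<close>.  They add up to \<open>\<integral>h\<^sup>p d\<delta>\<close> since
  the Bernstein polynomials sum to \<open>1\<close>.
\<close>

lemma Lp_norm_D_le:
  assumes p: "p > 1" and h: "choquet_integrable (emeasure \<delta>) h"
  shows "Lp_norm p \<mu> (D h) \<le> Lp_norm p (emeasure \<delta>) h"
proof (cases "Lp_norm p (emeasure \<delta>) h")
  case (real b)
  have hm[measurable]: "h \<in> borel_measurable borel01" and h0: "\<And>t. t \<in> {0..1} \<Longrightarrow> 0 \<le> h t"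
    using h by (auto simp: choquet_integrable_def)
  define hp where "hp = (\<lambda>t. h t powr p)"
  have hpm[measurable]: "hp \<in> borel_measurable borel01"
    unfolding hp_def by measurable
  have le_b: "choquet (emeasure \<delta>) hp \<le> ennreal (b powr p)"
  proof -
    have "choquet (emeasure \<delta>) hp = choquet (emeasure \<delta>) (\<lambda>t. \<bar>h t\<bar> powr p)"
      unfolding hp_def using h0 by (intro choquet_cong) simp
    also have "\<dots> \<le> ennreal (b powr p)"
      using real p by (simp add: Lp_norm_le_iff[symmetric])
    finally show ?thesis .
  qed
  then have hp: "choquet_integrable (emeasure \<delta>) hp"
    unfolding choquet_integrable_def using le_less_trans[OF le_b] by (auto simp: hp_def)
  have "choquet \<mu> (\<lambda>x. \<bar>D h x\<bar> powr p) \<le> choquet \<mu> (\<lambda>x. \<Sum>k\<le>n. coefficient k h powr p * Bernstein n k x)"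
  proof (intro \<mu>.choquet_mono)
    fix x :: real assume x: "x \<in> {0..1}"
    have "D h x powr p \<le> (\<Sum>k\<le>n. Bernstein n k x * coefficient k h powr p)"
      unfolding D_def using x
      by (intro powr_weighted_mean_le p) (auto intro: Bernstein_nonneg coefficient_nonneg)
    then show "\<bar>D h x\<bar> powr p \<le> (\<Sum>k\<le>n. coefficient k h powr p * Bernstein n k x)"
      using D_nonneg[OF x, of h] by (simp add: mult.commute)
  qed measurable
  also have "\<dots> \<le> (\<Sum>k\<le>n. choquet \<mu> (\<lambda>x. coefficient k h powr p * Bernstein n k x))"
    by (intro \<mu>.choquet_sum_le) (auto intro!: mult_nonneg_nonneg Bernstein_nonneg)
  also have "\<dots> \<le> (\<Sum>k\<le>n. choquet (emeasure \<delta>) (\<lambda>t. hp t * Bernstein n k t))"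
  proof (intro sum_mono)
    fix k assume "k \<in> {..n}"
    then interpret weighted_capacity "\<nu> k" "Bernstein n k"
      by (intro weighted_capacity_\<nu>) simp
    have "choquet \<mu> (\<lambda>x. coefficient k h powr p * Bernstein n k x)
        = ennreal (coefficient k h powr p) * choquet \<mu> (Bernstein n k)"
      by (intro \<mu>.choquet_cmult) auto
    also have "\<dots> \<le> ennreal (coefficient k hp) * choquet (\<nu> k) (Bernstein n k)"
      unfolding hp_def coefficient_def using hp
      by (intro mult_mono ennreal_leI mean_powr_le choquet_\<mu>_le_\<nu> choquet_integrable_\<nu> p h)
        (auto simp: hp_def)
    also have "\<dots> = choquet (\<nu> k) (\<lambda>t. hp t * Bernstein n k t)"
      unfolding coefficient_def by (intro mean_times_weight choquet_integrable_\<nu> hp)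
    also have "\<dots> \<le> choquet (emeasure \<delta>) (\<lambda>t. hp t * Bernstein n k t)"
      by (intro choquet_\<nu>_le_\<delta>) auto
    finally show "choquet \<mu> (\<lambda>x. coefficient k h powr p * Bernstein n k x)
        \<le> choquet (emeasure \<delta>) (\<lambda>t. hp t * Bernstein n k t)" .
  qed
  also have "\<dots> = (\<Sum>k\<le>n. \<integral>\<^sup>+t. hp t * Bernstein n k t \<partial>\<delta>)"
    by (intro sum.cong refl choquet_emeasure_\<delta>) (auto simp: hp_def intro!: mult_nonneg_nonneg Bernstein_nonneg)
  also have "\<dots> = (\<integral>\<^sup>+t. (\<Sum>k\<le>n. ennreal (hp t * Bernstein n k t)) \<partial>\<delta>)"
    by (subst nn_integral_sum)
      (auto simp: measurable_cong_sets[OF sets_measure refl])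
  also have "\<dots> = (\<integral>\<^sup>+t. hp t \<partial>\<delta>)"
  proof (intro nn_integral_cong)
    fix t assume "t \<in> space \<delta>"
    then have t: "t \<in> {0..1}"
      using sets_eq_imp_space_eq[OF sets_measure] by simp
    have "(\<Sum>k\<le>n. ennreal (hp t * Bernstein n k t)) = ennreal (\<Sum>k\<le>n. hp t * Bernstein n k t)"
      using t by (intro sum_ennreal) (auto simp: hp_def intro!: mult_nonneg_nonneg Bernstein_nonneg)
    then show "(\<Sum>k\<le>n. ennreal (hp t * Bernstein n k t)) = ennreal (hp t)"
      by (simp flip: sum_distrib_left)
  qed
  also have "\<dots> = choquet (emeasure \<delta>) hp"
    by (intro choquet_emeasure_\<delta>[symmetric]) (auto simp: hp_def)
  also have "\<dots> \<le> ennreal (b powr p)"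
    by (rule le_b)
  finally show ?thesis
    using real p by (simp add: Lp_norm_le_iff)
qed simp

lemma C1_plus_choquet_integrable:
  assumes "g \<in> C1_plus"
  shows "choquet_integrable (emeasure \<delta>) g"
proof -
  have cont: "continuous_on {0..1} g" and g0: "\<And>t. t \<in> {0..1} \<Longrightarrow> 0 \<le> g t"
    using assms differentiable_imp_continuous_on by (auto simp: C1_plus_def)
  have "compact (g ` {0..1})"
    by (intro compact_continuous_image cont) auto
  then obtain B where B: "\<And>t. t \<in> {0..1} \<Longrightarrow> \<bar>g t\<bar> \<le> B"
    using compact_imp_bounded bounded_iff by (metis imageI real_norm_def)
  show ?thesis
  proof (rule \<delta>.choquet_integrable_bounded)
    show "g \<in> borel_measurable borel01"
      unfolding borel01_def by (rule borel_measurable_continuous_on_restrict[OF cont])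
    show "0 \<le> g t \<and> g t \<le> B" if "t \<in> {0..1}" for t
      using B[OF that] g0[OF that] by auto
  qed
qed

text \<open>
  Constants are reproduced by the operator, so \<open>g(x)\<close> can be compared with \<open>D g x\<close> under \<open>D\<close>, where
  the Lipschitz bound for \<open>g\<close> applies.
\<close>

lemma Lp_norm_C1_minus_D_le:
  assumes p: "p > 1" and g: "g \<in> C1_plus"
  shows "Lp_norm p \<mu> (\<lambda>x. g x - D g x)
    \<le> Lp_norm p \<mu> (\<lambda>x. D (\<lambda>t. \<bar>t - x\<bar>) x) * sup_norm (\<lambda>s. vector_derivative g (at s within {0..1}))"
proof -
  obtain M where M: "0 \<le> M" "sup_norm (\<lambda>s. vector_derivative g (at s within {0..1})) = ennreal M"
    and lip: "\<And>x t. x \<in> {0..1} \<Longrightarrow> t \<in> {0..1} \<Longrightarrow> \<bar>g x - g t\<bar> \<le> M * \<bar>t - x\<bar>"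
    using C1_plus_Lipschitz[OF g] by blast
  note gi = C1_plus_choquet_integrable[OF g]
  note [measurable] = D_distance_measurable
  have gm[measurable]: "g \<in> borel_measurable borel01" and g0: "\<And>t. t \<in> {0..1} \<Longrightarrow> 0 \<le> g t"
    using gi by (auto simp: choquet_integrable_def)
  have "Lp_norm p \<mu> (\<lambda>x. g x - D g x) \<le> Lp_norm p \<mu> (\<lambda>x. M * D (\<lambda>t. \<bar>t - x\<bar>) x)"
  proof (intro \<mu>.Lp_norm_mono)
    fix x :: real assume x: "x \<in> {0..1}"
    have const: "choquet_integrable (emeasure \<delta>) (\<lambda>_. g x)"
      using g0[OF x] by (intro \<delta>.choquet_integrable_bounded) auto
    have "\<bar>g x - D g x\<bar> = \<bar>D (\<lambda>_. g x) x - D g x\<bar>"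
      using g0[OF x] by (simp add: D_const)
    also have "\<dots> \<le> D (\<lambda>t. \<bar>g x - g t\<bar>) x"
      by (rule abs_D_diff_le[OF const gi x])
    also have "\<dots> \<le> D (\<lambda>t. M * \<bar>t - x\<bar>) x"
      using x M(1)
      by (intro D_mono \<delta>.choquet_integrable_abs_diff \<delta>.choquet_integrable_cmult
          choquet_integrable_distance const gi lip)
    also have "\<dots> = M * D (\<lambda>t. \<bar>t - x\<bar>) x"
      by (intro D_cmult choquet_integrable_distance M)
    finally show "\<bar>g x - D g x\<bar> \<le> \<bar>M * D (\<lambda>t. \<bar>t - x\<bar>) x\<bar>"
      by simp
  qed (use p in auto)
  also have "\<dots> \<le> ennreal M * Lp_norm p \<mu> (\<lambda>x. D (\<lambda>t. \<bar>t - x\<bar>) x)"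
    using p M(1) by (intro \<mu>.Lp_norm_cmult_le) auto
  finally show ?thesis
    by (simp add: M(2) mult.commute)
qed

lemma Lp_plus_choquet_integrable:
  assumes p: "p > 1" and f: "f \<in> Lp_plus p (emeasure \<delta>)"
  shows "choquet_integrable (emeasure \<delta>) f"
proof (rule \<delta>.choquet_integrable_of_powr[OF p])
  have f0: "\<And>t. t \<in> {0..1} \<Longrightarrow> 0 \<le> f t" and fm: "f \<in> borel_measurable borel01"
    using f by (auto simp: Lp_plus_def Lp_def)
  show "f \<in> borel_measurable borel01" "\<And>t. t \<in> {0..1} \<Longrightarrow> 0 \<le> f t"
    using f0 fm by auto
  have "choquet (emeasure \<delta>) (\<lambda>t. f t powr p) = choquet (emeasure \<delta>) (\<lambda>t. \<bar>f t\<bar> powr p)"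
    using f0 by (intro choquet_cong) simp
  then show "choquet_integrable (emeasure \<delta>) (\<lambda>t. f t powr p)"
    using f fm by (auto simp: choquet_integrable_def Lp_plus_def Lp_def)
qed

text \<open>
  The usual argument for \<open>K\<close>-functionals: insert \<open>g\<close> and \<open>D g\<close> between \<open>f\<close> and \<open>D f\<close>.
\<close>

lemma Lp_norm_error_le:
  assumes p: "p > 1" and f: "f \<in> Lp_plus p (emeasure \<delta>)" and g: "g \<in> C1_plus"
  shows "Lp_norm p \<mu> (\<lambda>x. f x - D f x)
    \<le> Lp_norm p \<mu> (\<lambda>x. f x - g x) + Lp_norm p (emeasure \<delta>) (\<lambda>x. f x - g x)
      + Lp_norm p \<mu> (\<lambda>x. D (\<lambda>t. \<bar>t - x\<bar>) x) * sup_norm (\<lambda>s. vector_derivative g (at s within {0..1}))"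
proof -
  note fi = Lp_plus_choquet_integrable[OF p f] and gi = C1_plus_choquet_integrable[OF g]
  have fm[measurable]: "f \<in> borel_measurable borel01" and gm[measurable]: "g \<in> borel_measurable borel01"
    using fi gi by (auto simp: choquet_integrable_def)
  let ?h = "\<lambda>t. \<bar>f t - g t\<bar>"
  have hi: "choquet_integrable (emeasure \<delta>) ?h"
    by (rule \<delta>.choquet_integrable_abs_diff[OF fi gi])
  have "Lp_norm p \<mu> (\<lambda>x. f x - D f x)
      = Lp_norm p \<mu> (\<lambda>x. (f x - g x) + ((g x - D g x) + (D g x - D f x)))"
    by simp
  also have "\<dots> \<le> Lp_norm p \<mu> (\<lambda>x. f x - g x) + Lp_norm p \<mu> (\<lambda>x. (g x - D g x) + (D g x - D f x))"
    by (intro \<mu>.Minkowski_Lp_norm p) measurable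
  also have "\<dots> \<le> Lp_norm p \<mu> (\<lambda>x. f x - g x)
      + (Lp_norm p \<mu> (\<lambda>x. g x - D g x) + Lp_norm p \<mu> (\<lambda>x. D g x - D f x))"
    by (intro add_left_mono \<mu>.Minkowski_Lp_norm p) measurable
  also have "Lp_norm p \<mu> (\<lambda>x. D g x - D f x) \<le> Lp_norm p \<mu> (D ?h)"
  proof (intro \<mu>.Lp_norm_mono)
    fix x :: real assume x: "x \<in> {0..1}"
    show "\<bar>D g x - D f x\<bar> \<le> \<bar>D ?h x\<bar>"
      using abs_D_diff_le[OF fi gi x] by (simp add: abs_minus_commute)
  qed (use p in auto)
  also have "Lp_norm p \<mu> (D ?h) \<le> Lp_norm p (emeasure \<delta>) ?h"
    by (rule Lp_norm_D_le[OF p hi])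
  also have "Lp_norm p (emeasure \<delta>) ?h = Lp_norm p (emeasure \<delta>) (\<lambda>x. f x - g x)"
    by (simp add: Lp_norm_def)
  also note Lp_norm_C1_minus_D_le[OF p g]
  finally show ?thesis
    by (simp add: ac_simps add_mono)
qed

end

section \<open>The estimate by the K-functional\<close>

theorem theorem3p4:
  fixes \<mu> :: "real set \<Rightarrow> ennreal" and \<delta> :: "real measure" and p :: real
  assumes "sf_bounded \<mu>"
    and "sf_monotone \<mu>"
    and "sf_submodular \<mu>"
    and "sf_strictly_positive \<mu>"
    and "sf_continuous_incseq \<mu>"
    and "sets \<delta> = sets borel01"
    and "sf_bounded (emeasure \<delta>)"
    and "sf_strictly_positive (emeasure \<delta>)"
    and "\<forall>A\<in>sets borel01. \<mu> A \<le> emeasure \<delta> A"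
    and "p > 1"
  shows "Lp_plus p (emeasure \<delta>) \<subseteq> Lp_plus p \<mu> \<and>
    (\<forall>f\<in>Lp_plus p (emeasure \<delta>). \<forall>n::nat. n \<ge> 1 \<longrightarrow>
       Lp_norm p \<mu> (\<lambda>x. f x - D_bar n \<delta> \<mu> f x)
         \<le> 2 * K_bar p \<mu> (emeasure \<delta>) f
                (Lp_norm p \<mu> (\<lambda>x. D_bar n \<delta> \<mu> (\<lambda>t. \<bar>t - x\<bar>) x) / 2))"
proof (intro conjI ballI allI impI)
  show "Lp_plus p (emeasure \<delta>) \<subseteq> Lp_plus p \<mu>"
  proof
    fix f assume f: "f \<in> Lp_plus p (emeasure \<delta>)"
    then have "(\<lambda>t. \<bar>f t\<bar> powr p) \<in> borel_measurable borel01"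
      by (auto simp: Lp_plus_def Lp_def)
    then have "choquet \<mu> (\<lambda>t. \<bar>f t\<bar> powr p) \<le> choquet (emeasure \<delta>) (\<lambda>t. \<bar>f t\<bar> powr p)"
      using assms(9) by (intro choquet_capacity_mono) auto
    then show "f \<in> Lp_plus p \<mu>"
      using f le_less_trans by (auto simp: Lp_plus_def Lp_def)
  qed
next
  fix f and n :: nat assume f: "f \<in> Lp_plus p (emeasure \<delta>)"
  interpret bernstein_durrmeyer_choquet \<mu> \<delta> n
    using assms by unfold_locales auto
  have fi: "choquet_integrable (emeasure \<delta>) f"
    by (rule Lp_plus_choquet_integrable[OF \<open>p > 1\<close> f])
  have Df: "D_bar n \<delta> \<mu> f = D f"
    using fi by (intro D_bar_eq_D) (auto simp: choquet_integrable_def)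
  have D\<phi>: "D_bar n \<delta> \<mu> (\<lambda>t. \<bar>t - x\<bar>) = D (\<lambda>t. \<bar>t - x\<bar>)" for x
    using choquet_integrable_distance[of x] by (intro D_bar_eq_D) (auto simp: choquet_integrable_def)
  define X where "X = Lp_norm p \<mu> (\<lambda>x. f x - D f x)"
  define T where "T = Lp_norm p \<mu> (\<lambda>x. D (\<lambda>t. \<bar>t - x\<bar>) x)"
  have split_half: "(a + b * c) / 2 = a / 2 + b / 2 * c" for a b c :: ennreal
    by (simp only: divide_ennreal_def distrib_left distrib_right mult_ac)
  have half: "y / 2 \<le> y" for y :: ennreal
    by (intro divide_le_posI_ennreal) (simp_all add: mult_2 mult_2_right)
  have "X / 2 \<le> K_bar p \<mu> (emeasure \<delta>) f (T / 2)"
    unfolding K_bar_def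
  proof (intro INF_greatest)
    fix g assume g: "g \<in> C1_plus"
    let ?N = "Lp_norm p \<mu> (\<lambda>x. f x - g x)" and ?N' = "Lp_norm p (emeasure \<delta>) (\<lambda>x. f x - g x)"
      and ?s = "sup_norm (\<lambda>s. vector_derivative g (at s within {0..1}))"
    \<comment> \<open>The error bound is halved; the factor \<open>1/2\<close> is kept only where it belongs to the argument \<open>T / 2\<close>.\<close>
    have "X / 2 \<le> (?N + ?N' + T * ?s) / 2"
      unfolding X_def T_def by (intro divide_right_mono_ennreal Lp_norm_error_le \<open>p > 1\<close> f g)
    also have "\<dots> = (?N + ?N') / 2 + T / 2 * ?s"
      by (rule split_half)
    also have "\<dots> \<le> ?N + ?N' + T / 2 * ?s"
      by (intro add_right_mono half)
    finally show "X / 2 \<le> ?N + ?N' + T / 2 * ?s" .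
  qed
  then have "2 * (X / 2) \<le> 2 * K_bar p \<mu> (emeasure \<delta>) f (T / 2)"
    by (rule mult_left_mono) simp
  moreover have "2 * (X / 2) = X"
    by (simp add: ennreal_times_divide mult.commute[of 2] ennreal_mult_divide_eq)
  ultimately show "Lp_norm p \<mu> (\<lambda>x. f x - D_bar n \<delta> \<mu> f x)
      \<le> 2 * K_bar p \<mu> (emeasure \<delta>) f
          (Lp_norm p \<mu> (\<lambda>x. D_bar n \<delta> \<mu> (\<lambda>t. \<bar>t - x\<bar>) x) / 2)"
    by (simp add: Df D\<phi> X_def T_def)
qed

end
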